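(* Let $G=(V,E)$ be a finite connected simple graph with girth at least $6$, with $E=\{e_1,\dots,e_n\}$, $n\ge1$, and let $\overline{\kappa}=2\big(\frac{|V|}{|E|}-1\big)$. Let $r_0\in\mathbb{R}^n$ be an arbitrary initial value, let $s\in\mathbb{R}$ and let $p>1$. Then the solutions, with initial value $r(0)=r_0$, of the three Calabi flows $$\frac{d}{dt}r_i=\Delta\kappa_i,\qquad \frac{d}{dt}r_i=\Delta^s\kappa_i,\qquad \frac{d}{dt}r_i=\Delta_p(\kappa-\overline{\kappa})_i$$ (exist for all $t\ge0$ and) converge as $t\to\infty$ to a weight with constant curvature $\overline{\kappa}$, i.e. to a weight for which $\kappa_e=\overline{\kappa}$ for all $e\in E$, if and only if $$\max_{\emptyset\ne\Omega\subsetneq V}\frac{|E(\Omega)|}{|\Omega|}<\frac{|E|}{|V|},$$ where $E(\Omega)$ denotes the set of edges of the subgraph of $G$ induced by $\Omega$.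
   Context: The graph is undirected; girth at least $6$ means there are no cycles of length $3,4,5$ (an acyclic graph has infinite girth). A weight is a function $\omega:E\to\mathbb{R}_{>0}$, $\omega_i=\omega(e_i)$, parametrized by $r_i=\ln\omega_i$, $r=(r_1,\dots,r_n)\in\mathbb{R}^n$; convergence of the flow to a weight means convergence of $r(t)$ in $\mathbb{R}^n$ to the corresponding vector. For $x\in V$ let $m(x)=\sum_{e\ni x}\omega_e$ be the total weight of edges incident to $x$. The (Lin-Lu-Yau) curvature of an edge $e$ with endpoints $x,y$ is $$\kappa_e=2\omega_e\Big(\frac1{m(x)}+\frac1{m(y)}\Big)-2,$$ and $\kappa=\kappa(r)=(\kappa_1,\dots,\kappa_n)$ with $\kappa_i=\kappa_{e_i}$, regarded as a function of $r$. In $\kappa-\overline\kappa$, $\overline\kappa$ is viewed as the constant vector. Let $J=J(r)=\big(\frac{\partial\kappa_i}{\partial r_j}\big)_{n\times n}$; it is symmetric and positive semi-definite. The operators below depend on $r$ through $J$ and act on functions $g:E\to\mathbb{R}$ (vectors in $\mathbb{R}^n$): - Discrete Laplacian: $\Delta g_i=-\sum_{j=1}^n\frac{\partial\kappa_i}{\partial r_j}g_j$, i.e. $\Delta=-J$. - Fractional Laplacian, $s\in\mathbb{R}$: $\Delta^s=-J^s$, where, if $J=Q^{\mathrm T}\operatorname{diag}\{\lambda_1,\dots,\lambda_n\}Q$ with $Q$ orthogonal, $J^s=Q^{\mathrm T}\operatorname{diag}\{\lambda_1^s,\dots,\lambda_n^s\}Q$, with the convention $0^s=0$ for all $s\in\mathbb{R}$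 (including $s\le 0$). - $p$-Laplacian, $p>1$: $\Delta_p g_i=\sum_{j\sim i}\big(-\frac{\partial\kappa_i}{\partial r_j}\big)|g_j-g_i|^{p-2}(g_j-g_i)$, where $j\sim i$ means that $e_j\ne e_i$ share a vertex, and $|a|^{p-2}a$ is interpreted as $0$ when $a=0$. In the flows, the operators and $\kappa$ are evaluated at $r=r(t)$. "The solutions" means every maximal solution with the given initial value. *)

theory Defs
  imports "HOL-Analysis.Analysis" "HOL-Library.Extended_Nat"
begin

section \<open>Finite simple graphs\<close>

definition finite_simple_graph :: "'v set \<Rightarrow> 'v set set \<Rightarrow> bool" where
  "finite_simple_graph V E \<longleftrightarrow> finite V \<and> (\<forall>f\<in>E. f \<subseteq> V \<and> card f = 2)"

definition connected_graph :: "'v set \<Rightarrow> 'v set set \<Rightarrow> bool" where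
  "connected_graph V E \<longleftrightarrow> V \<noteq> {} \<and> (\<forall>x\<in>V. \<forall>y\<in>V. (x, y) \<in> {(u, v). {u, v} \<in> E}\<^sup>*)"

definition is_cycle :: "'v set set \<Rightarrow> 'v list \<Rightarrow> bool" where
  "is_cycle E vs \<longleftrightarrow> 3 \<le> length vs \<and> distinct vs \<and>
     (\<forall>i<length vs. {vs ! i, vs ! (Suc i mod length vs)} \<in> E)"

text \<open>The infimum of the empty set in \<^typ>\<open>enat\<close> is \<^term>\<open>\<infinity>\<close>, so acyclic graphs have infinite girth.\<close>

definition girth :: "'v set set \<Rightarrow> enat" where
  "girth E = (INF vs \<in> {vs. is_cycle E vs}. enat (length vs))"

definition induced_edges :: "'v set set \<Rightarrow> 'v set \<Rightarrow> 'v set set" where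
  "induced_edges E \<Omega> = {f \<in> E. f \<subseteq> \<Omega>}"


section \<open>Weights and Lin--Lu--Yau curvature\<close>

text \<open>The edges are enumerated by a map \<open>e\<close> from a finite index type \<open>'n\<close>, so that functions
  on the edge set are vectors in \<open>real ^ 'n\<close>.  The vector \<open>r\<close> encodes the positive weight
  \<open>\<omega>\<^sub>i = exp r\<^sub>i\<close>.\<close>

definition edge_weight :: "real ^ 'n \<Rightarrow> 'n \<Rightarrow> real" where
  "edge_weight r i = exp (r $ i)"

definition vertex_mass :: "('n::finite \<Rightarrow> 'v set) \<Rightarrow> real ^ 'n \<Rightarrow> 'v \<Rightarrow> real" where
  "vertex_mass e r x = (\<Sum>i \<in> {i. x \<in> e i}. edge_weight r i)"

text \<open>The inner sum runs over the two endpoints of the edge \<open>e i\<close>.\<close>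

definition curvature :: "('n::finite \<Rightarrow> 'v set) \<Rightarrow> real ^ 'n \<Rightarrow> real ^ 'n" where
  "curvature e r = (\<chi> i. 2 * edge_weight r i * (\<Sum>x \<in> e i. 1 / vertex_mass e r x) - 2)"

definition mean_curvature :: "'v set \<Rightarrow> 'v set set \<Rightarrow> real" where
  "mean_curvature V E = 2 * (real (card V) / real (card E) - 1)"

definition curvature_jacobian :: "('n::finite \<Rightarrow> 'v set) \<Rightarrow> real ^ 'n \<Rightarrow> real ^ 'n ^ 'n" where
  "curvature_jacobian e r = jacobian (curvature e) (at r)"


section \<open>Laplacians\<close>

definition diag_matrix :: "real ^ 'n \<Rightarrow> real ^ 'n ^ 'n" where
  "diag_matrix d = (\<chi> i j. if i = j then d $ i else 0)"

text \<open>Intended for symmetric positive semi-definite \<open>A\<close>, where the value does not depend on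
  the diagonalization.  Since \<open>0 powr s = 0\<close> for every \<open>s\<close>, the convention \<open>0\<^sup>s = 0\<close>
  (also for \<open>s \<le> 0\<close>) is built in.\<close>

definition matrix_real_power :: "real ^ 'n ^ 'n \<Rightarrow> real \<Rightarrow> real ^ 'n ^ 'n" where
  "matrix_real_power A s = (THE B. \<exists>Q d. orthogonal_matrix Q \<and>
      A = transpose Q ** diag_matrix d ** Q \<and>
      B = transpose Q ** diag_matrix (\<chi> i. d $ i powr s) ** Q)"

definition laplacian :: "('n::finite \<Rightarrow> 'v set) \<Rightarrow> real ^ 'n \<Rightarrow> real ^ 'n \<Rightarrow> real ^ 'n" where
  "laplacian e r g = - (curvature_jacobian e r *v g)"

definition frac_laplacian ::
  "real \<Rightarrow> ('n::finite \<Rightarrow> 'v set) \<Rightarrow> real ^ 'n \<Rightarrow> real ^ 'n \<Rightarrow> real ^ 'n" where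
  "frac_laplacian s e r g = - (matrix_real_power (curvature_jacobian e r) s *v g)"

text \<open>For \<open>a = 0\<close> the factor \<open>\<bar>a\<bar> powr (p - 2) * a\<close> is \<open>0\<close>.\<close>

definition p_laplacian ::
  "real \<Rightarrow> ('n::finite \<Rightarrow> 'v set) \<Rightarrow> real ^ 'n \<Rightarrow> real ^ 'n \<Rightarrow> real ^ 'n" where
  "p_laplacian p e r g = (\<chi> i. \<Sum>j \<in> {j. e j \<noteq> e i \<and> e j \<inter> e i \<noteq> {}}.
      (- curvature_jacobian e r $ i $ j) * (\<bar>g $ j - g $ i\<bar> powr (p - 2) * (g $ j - g $ i)))"


section \<open>Flows\<close>

definition ivp_solution ::
  "('b::real_normed_vector \<Rightarrow> 'b) \<Rightarrow> 'b \<Rightarrow> real set \<Rightarrow> (real \<Rightarrow> 'b) \<Rightarrow> bool" where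
  "ivp_solution F r0 I r \<longleftrightarrow> is_interval I \<and> 0 \<in> I \<and> I \<subseteq> {0..} \<and> I \<noteq> {0} \<and> r 0 = r0 \<and>
     (\<forall>t\<in>I. (r has_vector_derivative F (r t)) (at t within I))"

definition maximal_solution ::
  "('b::real_normed_vector \<Rightarrow> 'b) \<Rightarrow> 'b \<Rightarrow> real set \<Rightarrow> (real \<Rightarrow> 'b) \<Rightarrow> bool" where
  "maximal_solution F r0 I r \<longleftrightarrow> ivp_solution F r0 I r \<and>
     (\<forall>I' r'. ivp_solution F r0 I' r' \<and> I \<subseteq> I' \<and> (\<forall>t\<in>I. r' t = r t) \<longrightarrow> I' = I)"

text \<open>Solutions need not be unique (the \<open>p\<close>-Laplacian is not Lipschitz for \<open>p < 2\<close>), hence the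
  quantification over all maximal solutions; the first conjunct excludes vacuous truth.\<close>

definition solutions_converge_to ::
  "('b::real_normed_vector \<Rightarrow> 'b) \<Rightarrow> 'b \<Rightarrow> ('b \<Rightarrow> bool) \<Rightarrow> bool" where
  "solutions_converge_to F r0 P \<longleftrightarrow> (\<exists>I r. maximal_solution F r0 I r) \<and>
     (\<forall>I r. maximal_solution F r0 I r \<longrightarrow>
        I = {0..} \<and> (\<exists>l. (r \<longlongrightarrow> l) at_top \<and> P l))"

end

theory Submission
  imports Defs "HOL-Complex_Analysis.Great_Picard"
begin

text \<open>The curvature deviation \<open>\<kappa> - \<kappa>bar\<close> is the gradient of the convex function
  \<open>\<Phi>(r) = 2 \<Sum>\<^sub>x ln m(x) - 2 |V|/|E| \<Sum>\<^sub>i r\<^sub>i\<close>, and \<open>J\<close>, its Hessian, is a weighted graph Laplacian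
  on the line graph of \<open>G\<close>.  All three flows preserve \<open>\<Sum>\<^sub>i r\<^sub>i\<close> and strictly decrease \<open>\<Phi>\<close> away from
  constant curvature, so they converge as soon as \<open>\<Phi>\<close> is proper on the hyperplanes of constant
  \<open>\<Sum>\<^sub>i r\<^sub>i\<close>.  A layer-cake argument derives properness from the density condition.  Conversely, at a
  weight of constant curvature, summing \<open>\<omega>\<^sub>e (1/m(x) + 1/m(y)) = |V|/|E|\<close> over the edges inside \<open>\<Omega>\<close>
  gives less than \<open>|\<Omega>|\<close>, since by connectedness some edge leaves \<open>\<Omega>\<close>.

  The vector fields are only continuous, so existence of solutions rests on Peano's theorem, obtained
  from Euler polygons by a diagonal argument.\<close>

section \<open>Existence of solutions for continuous vector fields\<close>

text \<open>The working variables are the shares \<open>share r x i\<close>, the fraction of the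
  mass at x carried by edge i. At each vertex they form a probability vector, and the curvature of
  an edge is twice its total share minus 2. Differentiating them yields J, and Jensen's inequality
  with these weights shows that a critical weight is a strict minimum.

  Two irregularities shape the analysis. For p < 2 the map |a|^(p-2) a is not Lipschitz at 0. For s
  \<le> 0 the convention 0^s = 0 makes A^s jump where the rank of A drops, and J is always singular;
  but connectedness fixes the kernel of J(r) to be the constants for every r, so the rank never
  drops along the flow. With merely continuous fields a solution may branch, so convergence is
  proved for each solution separately: the Lyapunov function confines all of them to one compact
  set.\<close>

lemma ivp_solution_atLeastI:
  assumes "x 0 = x0" "\<And>t. t \<ge> 0 \<Longrightarrow> (x has_vector_derivative F (x t)) (at t within {0..})"
  shows "ivp_solution F x0 {0..} x"
proof -
  have "(1 :: real) \<in> {0..}" "(1 :: real) \<notin> {0}" by simp_all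
  then have "{0 :: real..} \<noteq> {0}" by metis
  then show ?thesis using assms by (simp add: ivp_solution_def is_interval_ci)
qed

section \<open>Euler polygons and Peano's theorem\<close>

definition euler_step :: "('b::real_normed_vector \<Rightarrow> 'b) \<Rightarrow> 'b \<Rightarrow> real \<Rightarrow> nat \<Rightarrow> 'b" where
  "euler_step Y x0 h k = ((\<lambda>z. z + h *\<^sub>R Y z) ^^ k) x0"

lemma euler_step_0 [simp]: "euler_step Y x0 h 0 = x0"
  by (simp add: euler_step_def)

lemma euler_step_Suc [simp]:
  "euler_step Y x0 h (Suc k) = euler_step Y x0 h k + h *\<^sub>R Y (euler_step Y x0 h k)"
  by (simp add: euler_step_def)

text \<open>The errors of the single steps add up. There are two uses: v = 0 turns a bound on the
  field into a speed bound, and v = \<open>Y (x s)\<close> becomes the derivative estimate in the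
  limit of step size zero.\<close>

lemma euler_step_linearization:
  assumes "k \<le> m" "h \<ge> 0" "\<And>j. k \<le> j \<Longrightarrow> j < m \<Longrightarrow> norm (Y (euler_step Y x0 h j) - v) \<le> \<epsilon>"
  shows "norm (euler_step Y x0 h m - euler_step Y x0 h k - ((real m - real k) * h) *\<^sub>R v)
    \<le> (real m - real k) * h * \<epsilon>"
  using assms(1,3)
proof (induction m rule: dec_induct)
  case (step m)
  let ?z = "euler_step Y x0 h"
  have "?z (Suc m) - ?z k - ((real (Suc m) - real k) * h) *\<^sub>R v =
      (?z m - ?z k - ((real m - real k) * h) *\<^sub>R v) + h *\<^sub>R (Y (?z m) - v)"
    by (simp add: algebra_simps)
  also have "norm \<dots> \<le> (real m - real k) * h * \<epsilon> + h * \<epsilon>"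
  proof (rule norm_triangle_mono)
    show "norm (?z m - ?z k - ((real m - real k) * h) *\<^sub>R v) \<le> (real m - real k) * h * \<epsilon>"
      using step by simp
    show "norm (h *\<^sub>R (Y (?z m) - v)) \<le> h * \<epsilon>"
      using step \<open>h \<ge> 0\<close> by (simp add: mult_left_mono)
  qed
  finally show ?case by (simp add: algebra_simps)
qed simp

lemma euler_step_lipschitz:
  assumes "h \<ge> 0" "\<And>x. norm (Y x) \<le> M"
  shows "norm (euler_step Y x0 h m - euler_step Y x0 h k) \<le> \<bar>real m * h - real k * h\<bar> * M"
proof -
  have *: "norm (euler_step Y x0 h m - euler_step Y x0 h k) \<le> \<bar>real m * h - real k * h\<bar> * M"
    if "k \<le> m" for k m
  proof -
    have "0 \<le> (real m - real k) * h" using that assms(1) by simp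
    then show ?thesis
      using euler_step_linearization[OF that assms(1), of Y x0 0 M] assms(2)
      by (simp add: left_diff_distrib)
  qed
  show ?thesis
    using *[of k m] *[of m k] by (cases "k \<le> m") (auto simp: norm_minus_commute abs_minus_commute)
qed

text \<open>A bound on the field makes the polygons Lipschitz up to one step, so a subsequence that
  converges at all rational times converges at every time. \<open>X n t\<close> is the value at the
  last node not after t, which avoids interpolation; the price is the extra \<open>h n\<close> in
  \<open>Xlip\<close>.\<close>

theorem peano_bounded:
  fixes Y :: "'b::euclidean_space \<Rightarrow> 'b"
  assumes Y: "continuous_on UNIV Y" and M: "\<And>x. norm (Y x) \<le> M"
  obtains x where "ivp_solution Y x0 {0..} x"
proof -
  define h where "h n = 1 / (real n + 1)" for n :: nat
  have h: "h n > 0" "h n \<le> 1" for n by (auto simp: h_def)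
  have h0: "h \<longlonglongrightarrow> 0"
    unfolding h_def using LIMSEQ_inverse_real_of_nat by (simp add: inverse_eq_divide add.commute)
  have M0: "M \<ge> 0" using M[of 0] norm_ge_zero order_trans by blast
  define idx where "idx n t = nat \<lfloor>t / h n\<rfloor>" for n t
  define z where "z n = euler_step Y x0 (h n)" for n
  define X where "X n t = z n (idx n t)" for n t
  have idx: "t - h n \<le> real (idx n t) * h n" "real (idx n t) * h n \<le> t" if "t \<ge> 0" for n t
  proof -
    have "real (idx n t) = of_int \<lfloor>t / h n\<rfloor>" using that h[of n] by (simp add: idx_def)
    moreover have "of_int \<lfloor>t / h n\<rfloor> \<le> t / h n" "t / h n - 1 \<le> of_int \<lfloor>t / h n\<rfloor>" by linarith+
    ultimately show "t - h n \<le> real (idx n t) * h n" "real (idx n t) * h n \<le> t"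
      using h(1)[of n] mult_right_mono[of "of_int \<lfloor>t / h n\<rfloor>" "t / h n" "h n"]
        mult_right_mono[of "t / h n - 1" "of_int \<lfloor>t / h n\<rfloor>" "h n"]
      by (simp_all add: left_diff_distrib)
  qed
  have X0: "X n 0 = x0" for n by (simp add: X_def idx_def z_def)
  have Xlip: "norm (X n t - X n s) \<le> (\<bar>t - s\<bar> + h n) * M" if "s \<ge> 0" "t \<ge> 0" for n s t
  proof -
    have "norm (X n t - X n s) \<le> \<bar>real (idx n t) * h n - real (idx n s) * h n\<bar> * M"
      unfolding X_def z_def by (rule euler_step_lipschitz) (use h[of n] M in auto)
    also have "\<dots> \<le> (\<bar>t - s\<bar> + h n) * M"
      using idx[of t n] idx[of s n] that by (intro mult_right_mono M0) linarith
    finally show ?thesis .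
  qed
  \<comment> \<open>The diagonal argument wants one bound for all times, while the polygons may grow
    linearly; dividing by 1 + t makes them bounded. The factor is undone at each time
    separately.\<close>
  obtain k where k: "strict_mono k" and
    klim: "\<And>t. t \<in> {t \<in> \<rat>. t \<ge> 0} \<Longrightarrow> \<exists>l. (\<lambda>n. X (k n) t /\<^sub>R (1 + t)) \<longlonglongrightarrow> l"
  proof (rule function_convergent_subsequence[of "{t\<in>\<rat>. t \<ge> (0::real)}" "\<lambda>n t. X n t /\<^sub>R (1 + t)" "norm x0 + M"])
    show "countable {t\<in>\<rat>. t \<ge> (0::real)}"
      by (rule countable_subset[OF _ countable_rat]) auto
    fix n :: nat and t :: real assume "t \<in> {t\<in>\<rat>. t \<ge> (0::real)}"
    then have t: "t \<ge> 0" by simp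
    have "norm (X n t) \<le> norm x0 + norm (X n t - X n 0)"
      unfolding X0 by (metis add.commute diff_add_cancel norm_triangle_ineq)
    also have "norm (X n t - X n 0) \<le> (t + h n) * M" using Xlip[of 0 t n] t by simp
    also have "\<dots> \<le> (1 + t) * M" using h(2)[of n] M0 by (intro mult_right_mono) auto
    also have "norm x0 \<le> (1 + t) * norm x0" using t by (simp add: algebra_simps)
    finally have "norm (X n t) \<le> (1 + t) * (norm x0 + M)" by (simp add: algebra_simps)
    then show "norm (X n t /\<^sub>R (1 + t)) \<le> norm x0 + M"
      using t by (simp add: field_simps)
  qed blast
  have hk0: "(\<lambda>n. h (k n)) \<longlonglongrightarrow> 0"
    using LIMSEQ_subseq_LIMSEQ[OF h0 k] by (simp add: o_def)
  have "convergent (\<lambda>n. X (k n) t)" if t: "t \<ge> 0" for t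
  proof -
    have "Cauchy (\<lambda>n. X (k n) t)"
    proof (rule metric_CauchyI)
      fix \<epsilon> :: real assume \<epsilon>: "\<epsilon> > 0"
      \<comment> \<open>The time gap and the step size will both be below \<delta>, so moving from t
        to q costs less than 2 \<delta> (M + 1) = \<epsilon> / 4. M + 1 replaces M because M may be
        0.\<close>
      define \<delta> where "\<delta> = \<epsilon> / (8 * (M + 1))"
      have \<delta>: "\<delta> > 0" using \<epsilon> M0 by (simp add: \<delta>_def)
      obtain q where q: "q \<in> \<rat>" "t < q" "q < t + \<delta>"
        using Rats_dense_in_real[of t "t + \<delta>"] \<delta> by auto
      obtain l where l: "(\<lambda>n. X (k n) q /\<^sub>R (1 + q)) \<longlonglongrightarrow> l" using klim[of q] q t by auto
      have "(\<lambda>n. (1 + q) *\<^sub>R (X (k n) q /\<^sub>R (1 + q))) \<longlonglongrightarrow> (1 + q) *\<^sub>R l"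
        by (intro tendsto_intros l)
      moreover have "(1 + q) *\<^sub>R (X (k n) q /\<^sub>R (1 + q)) = X (k n) q" for n
        using q t by simp
      ultimately have "Cauchy (\<lambda>n. X (k n) q)"
        by (auto intro: LIMSEQ_imp_Cauchy)
      then obtain N1 where N1: "\<And>m n. m \<ge> N1 \<Longrightarrow> n \<ge> N1 \<Longrightarrow> dist (X (k m) q) (X (k n) q) < \<epsilon> / 2"
        using \<epsilon> by (meson half_gt_zero metric_CauchyD)
      obtain N2 where N2: "\<And>n. n \<ge> N2 \<Longrightarrow> h (k n) < \<delta>"
        using order_tendstoD(2)[OF hk0 \<delta>] by (auto simp: eventually_sequentially)
      have near: "dist (X (k n) t) (X (k n) q) < \<epsilon> / 4" if "n \<ge> N2" for n
      proof -
        have "dist (X (k n) t) (X (k n) q) \<le> (\<bar>t - q\<bar> + h (k n)) * M"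
          using Xlip[of q t "k n"] q t by (simp add: dist_norm)
        also have "\<dots> \<le> (2 * \<delta>) * M" using q N2[OF that] by (intro mult_right_mono M0) auto
        also have "\<dots> < 2 * \<delta> * (M + 1)" using \<delta> by simp
        also have "\<dots> = \<epsilon> / 4" using M0 by (simp add: \<delta>_def field_simps)
        finally show ?thesis .
      qed
      show "\<exists>N. \<forall>m\<ge>N. \<forall>n\<ge>N. dist (X (k m) t) (X (k n) t) < \<epsilon>"
      proof (intro exI allI impI)
        fix m n assume "m \<ge> max N1 N2" "n \<ge> max N1 N2"
        then have "dist (X (k m) t) (X (k m) q) < \<epsilon> / 4" "dist (X (k n) t) (X (k n) q) < \<epsilon> / 4"
          "dist (X (k m) q) (X (k n) q) < \<epsilon> / 2" using near N1 by auto
        then show "dist (X (k m) t) (X (k n) t) < \<epsilon>"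
          by metric
      qed
    qed
    then show ?thesis by (rule Cauchy_convergent)
  qed
  then obtain x where x: "\<And>t. t \<ge> 0 \<Longrightarrow> (\<lambda>n. X (k n) t) \<longlonglongrightarrow> x t"
    unfolding convergent_def by metis
  have idxlim: "(\<lambda>n. real (idx (k n) t) * h (k n)) \<longlonglongrightarrow> t" if "t \<ge> 0" for t
  proof (rule tendsto_sandwich)
    show "(\<lambda>n. t - h (k n)) \<longlonglongrightarrow> t" using tendsto_diff[OF tendsto_const hk0, of t] by simp
    show "(\<lambda>n. t) \<longlonglongrightarrow> t" by simp
  qed (use idx that in auto)
  have der: "(x has_vector_derivative Y (x s)) (at s within {0..})" if s: "s \<ge> 0" for s
    unfolding has_vector_derivative_def has_derivative_within_alt
  proof (intro conjI allI impI)
    show "bounded_linear (\<lambda>t. t *\<^sub>R Y (x s))" by (rule bounded_linear_scaleR_left)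
    fix \<epsilon> :: real assume \<epsilon>: "\<epsilon> > 0"
    obtain \<delta>' where \<delta>': "\<delta>' > 0" "\<And>y. dist y (x s) < \<delta>' \<Longrightarrow> dist (Y y) (Y (x s)) < \<epsilon>"
      using Y \<epsilon> unfolding continuous_on_iff by (metis UNIV_I)
    define \<delta> where "\<delta> = \<delta>' / (4 * (M + 1))"
    have \<delta>: "\<delta> > 0" using \<delta>' M0 by (simp add: \<delta>_def)
    \<comment> \<open>With s at either end of the interval this covers right and left difference
      quotients. All nodes visited between a and b lie within time 2 \<delta> of s, hence for large
      n within \<open>\<delta>'\<close> of \<open>x s\<close>, where the field is \<epsilon>-close
      to \<open>Y (x s)\<close>.\<close>
    have key: "norm (x b - x a - (b - a) *\<^sub>R Y (x s)) \<le> (b - a) * \<epsilon>"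
      if ab: "0 \<le> a" "a \<le> b" "s - \<delta> < a" "b < s + \<delta>" for a b
    proof (rule LIMSEQ_le)
      let ?i = "\<lambda>t n. real (idx (k n) t) * h (k n)"
      show "(\<lambda>n. norm (X (k n) b - X (k n) a - (?i b n - ?i a n) *\<^sub>R Y (x s)))
          \<longlonglongrightarrow> norm (x b - x a - (b - a) *\<^sub>R Y (x s))"
        using ab by (intro tendsto_intros x idxlim) auto
      show "(\<lambda>n. (?i b n - ?i a n) * \<epsilon>) \<longlonglongrightarrow> (b - a) * \<epsilon>"
        using ab by (intro tendsto_intros idxlim) auto
      obtain N1 where N1: "\<And>n. n \<ge> N1 \<Longrightarrow> dist (X (k n) s) (x s) < \<delta>' / 4"
        using x[OF s] \<delta>'(1) by (metis metric_LIMSEQ_D zero_less_divide_iff zero_less_numeral)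
      obtain N2 where N2: "\<And>n. n \<ge> N2 \<Longrightarrow> h (k n) < \<delta>"
        using order_tendstoD(2)[OF hk0 \<delta>] by (auto simp: eventually_sequentially)
      show "\<exists>N. \<forall>n\<ge>N. norm (X (k n) b - X (k n) a - (?i b n - ?i a n) *\<^sub>R Y (x s))
          \<le> (?i b n - ?i a n) * \<epsilon>"
      proof (intro exI allI impI)
        fix n assume n: "n \<ge> max N1 N2"
        have le: "idx (k n) a \<le> idx (k n) b"
          unfolding idx_def using ab h[of "k n"]
          by (intro nat_mono floor_mono divide_right_mono) auto
        have "norm (X (k n) b - X (k n) a - ((real (idx (k n) b) - real (idx (k n) a)) * h (k n)) *\<^sub>R Y (x s))
          \<le> (real (idx (k n) b) - real (idx (k n) a)) * h (k n) * \<epsilon>"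
          unfolding X_def z_def
        proof (rule euler_step_linearization[OF le])
          show "h (k n) \<ge> 0" using h[of "k n"] by simp
          fix j assume j: "idx (k n) a \<le> j" "j < idx (k n) b"
          have j': "real (idx (k n) a) * h (k n) \<le> real j * h (k n)"
            "real j * h (k n) \<le> real (idx (k n) b) * h (k n)"
            using j h[of "k n"] by (auto intro!: mult_right_mono)
          have "norm (z (k n) j - X (k n) s) \<le> \<bar>real j * h (k n) - ?i s n\<bar> * M"
            unfolding X_def z_def by (rule euler_step_lipschitz) (use h[of "k n"] M in auto)
          also have "\<dots> \<le> (2 * \<delta>) * M"
          proof (rule mult_right_mono[OF _ M0])
            have "h (k n) < \<delta>" using N2 n by simp
            then show "\<bar>real j * h (k n) - ?i s n\<bar> \<le> 2 * \<delta>"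
              using j' idx[of a "k n"] idx[of b "k n"] idx[OF s, of "k n"] ab by linarith
          qed
          also have "\<dots> \<le> 2 * \<delta> * (M + 1)" using \<delta> by simp
          also have "\<dots> = \<delta>' / 2" using M0 by (simp add: \<delta>_def field_simps)
          finally have "dist (z (k n) j) (X (k n) s) \<le> \<delta>' / 2" by (simp add: dist_norm)
          moreover have "dist (X (k n) s) (x s) < \<delta>' / 4" using N1 n by simp
          ultimately have "dist (z (k n) j) (x s) < \<delta>'" using \<delta>'(1) by metric
          then show "norm (Y (euler_step Y x0 (h (k n)) j) - Y (x s)) \<le> \<epsilon>"
            using \<delta>'(2) by (force simp: z_def dist_norm)
        qed
        then show "norm (X (k n) b - X (k n) a - (?i b n - ?i a n) *\<^sub>R Y (x s))
          \<le> (?i b n - ?i a n) * \<epsilon>" by (simp add: left_diff_distrib)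
      qed
    qed
    show "\<exists>d>0. \<forall>y\<in>{0..}. norm (y - s) < d \<longrightarrow>
      norm (x y - x s - (y - s) *\<^sub>R Y (x s)) \<le> \<epsilon> * norm (y - s)"
    proof (intro exI[of _ \<delta>] conjI \<delta> ballI impI)
      fix y assume y: "y \<in> {0..}" "norm (y - s) < \<delta>"
      show "norm (x y - x s - (y - s) *\<^sub>R Y (x s)) \<le> \<epsilon> * norm (y - s)"
      proof (cases "s \<le> y")
        case True
        then show ?thesis using key[of s y] y s \<delta> by (simp add: mult.commute)
      next
        case False
        have "norm (x y - x s - (y - s) *\<^sub>R Y (x s)) = norm (x s - x y - (s - y) *\<^sub>R Y (x s))"
          by (subst norm_minus_cancel[symmetric]) (simp add: algebra_simps)
        then show ?thesis using key[of y s] y s \<delta> False by (simp add: mult.commute)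
      qed
    qed
  qed
  have "x 0 = x0" using x[of 0] by (simp add: X0 LIMSEQ_const_iff)
  then have "ivp_solution Y x0 {0..} x"
    using der by (intro ivp_solution_atLeastI)
  then show thesis by (rule that)
qed

section \<open>Continuation of solutions\<close>

lemma ivp_solution_append:
  assumes r: "ivp_solution F x0 {0..T} r" and u: "ivp_solution F (r T) {0..} u"
  shows "ivp_solution F x0 {0..} (\<lambda>t. if t \<in> {0..T} then r t else u (t - T))"
proof -
  have T: "T > 0" using r by (auto simp: ivp_solution_def order_le_less)
  have "((\<lambda>t. if t \<in> {0..T} then r t else u (t - T)) has_vector_derivative
      (if t \<in> {0..T} then F (r t) else F (u (t - T)))) (at t within {0..})" if t: "t \<ge> 0" for t
  proof (rule has_vector_derivative_If_within_closures[where T = "{T..}"])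
    show "t \<in> {0..T} \<union> {T..}" "{0..} = {0..T} \<union> {T..}" using t T by auto
    have c: "closure {0..T} \<inter> closure {T..} = {T}" using T by auto
    have eq: "{0..T} \<union> {T} = {0..T}" "{T..} \<union> {T} = {T..}" using T by auto
    show "(r has_vector_derivative F (r t)) (at t within {0..T} \<union> closure {0..T} \<inter> closure {T..})"
      if "t \<in> {0..T} \<union> closure {0..T} \<inter> closure {T..}"
      using that r unfolding c eq by (simp add: ivp_solution_def)
    show "((\<lambda>t. u (t - T)) has_vector_derivative F (u (t - T)))
        (at t within {T..} \<union> closure {0..T} \<inter> closure {T..})"
      if "t \<in> {T..} \<union> closure {0..T} \<inter> closure {T..}"
    proof -
      have "(\<lambda>t. t - T) ` {T..} = {0..}"
        by (auto simp: image_iff intro!: bexI[of _ "_ + T"])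
      moreover have "(u has_vector_derivative F (u (t - T))) (at (t - T) within {0..})"
        using that u unfolding c eq by (simp add: ivp_solution_def)
      moreover have "((\<lambda>t. t - T) has_vector_derivative 1) (at t within {T..})"
        by (auto intro!: derivative_eq_intros)
      ultimately have "(u \<circ> (\<lambda>t. t - T) has_vector_derivative 1 *\<^sub>R F (u (t - T))) (at t within {T..})"
        by (intro vector_diff_chain_within) auto
      then show ?thesis unfolding c eq by (simp add: o_def)
    qed
    show "r t = u (t - T)" "F (r t) = F (u (t - T))" if "t \<in> closure {0..T}" "t \<in> closure {T..}"
      using that u by (auto simp: ivp_solution_def dest!: antisym)
  qed
  then have "((\<lambda>t. if t \<in> {0..T} then r t else u (t - T)) has_vector_derivative
      F (if t \<in> {0..T} then r t else u (t - T))) (at t within {0..})" if t: "t \<ge> 0" for t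
    using t unfolding if_distrib[of F] by simp
  moreover have "r 0 = x0" using r by (simp add: ivp_solution_def)
  ultimately show ?thesis
    using T by (intro ivp_solution_atLeastI) auto
qed

text \<open>On the bounded range of \<open>r\<close> the field is bounded, so \<open>r\<close> is
  Lipschitz and extends continuously to T. Differentiability at T is then read off the integral
  equation, which passes to the closure by continuity.\<close>

lemma ivp_solution_extend_closed:
  fixes F :: "'b::euclidean_space \<Rightarrow> 'b"
  assumes F: "continuous_on UNIV F" and r: "ivp_solution F x0 {0..<T} r"
    and bdd: "bounded (r ` {0..<T})"
  obtains g where "ivp_solution F x0 {0..T} g" "\<And>t. t \<in> {0..<T} \<Longrightarrow> g t = r t"
proof -
  have T: "T > 0" using r by (auto simp: ivp_solution_def)
  have der: "(r has_vector_derivative F (r t)) (at t within {0..<T})" if "t \<in> {0..<T}" for t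
    using r that by (simp add: ivp_solution_def)
  have "compact (F ` closure (r ` {0..<T}))"
    using bdd F by (metis compact_closure compact_continuous_image continuous_on_subset subset_UNIV)
  then obtain M where M: "\<And>y. y \<in> closure (r ` {0..<T}) \<Longrightarrow> norm (F y) \<le> M"
    by (meson bounded_iff compact_imp_bounded imageI)
  have M': "norm (F (r t)) \<le> M" if "t \<in> {0..<T}" for t
    by (rule M[OF subsetD[OF closure_subset imageI[OF that]]])
  have "M \<ge> 0" using order_trans[OF norm_ge_zero M'[of 0]] T by simp
  have "M-lipschitz_on {0..<T} r"
  proof (rule lipschitz_onI[OF _ \<open>M \<ge> 0\<close>])
    fix s t assume st: "s \<in> {0..<T}" "t \<in> {0..<T}"
    have "norm (r s - r t) \<le> M * norm (s - t)"
    proof (rule differentiable_bound[OF _ der[unfolded has_vector_derivative_def] _ st])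
      show "onorm (\<lambda>x. x *\<^sub>R F (r x')) \<le> M" if "x' \<in> {0..<T}" for x'
        using M'[OF that] by (intro onorm_le) (simp add: mult.commute[of M] mult_left_mono)
    qed auto
    then show "dist (r s) (r t) \<le> M * dist s t" by (simp add: dist_norm)
  qed
  then have "uniformly_continuous_on {0..<T} r" by (rule lipschitz_on_uniformly_continuous)
  then obtain g where g: "uniformly_continuous_on (closure {0..<T}) g" "\<And>t. t \<in> {0..<T} \<Longrightarrow> r t = g t"
    using uniformly_continuous_on_extension_on_closure by metis
  have clos: "closure {0..<T} = {0..T}" using T by simp
  have cg: "continuous_on {0..T} g" using g(1) uniformly_continuous_imp_continuous clos by metis
  have cFg: "continuous_on {0..T} (\<lambda>t. F (g t))"
    using continuous_on_compose2[OF F cg] by auto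
  have I: "g t - integral {0..t} (\<lambda>t. F (g t)) = x0" if t: "t \<in> {0..T}" for t
  proof (rule continuous_constant_on_closure[of "{0..<T}"])
    show "continuous_on (closure {0..<T}) (\<lambda>t. g t - integral {0..t} (\<lambda>t. F (g t)))"
      unfolding clos
      by (intro continuous_intros cg indefinite_integral_continuous_1 integrable_continuous_real cFg)
    show "t \<in> closure {0..<T}" using t clos by simp
    fix t assume t: "t \<in> {0..<T}"
    have "((\<lambda>t. F (g t)) has_integral g t - g 0) {0..t}"
    proof (rule fundamental_theorem_of_calculus)
      fix s assume s: "s \<in> {0..t}"
      then have "(r has_vector_derivative F (r s)) (at s within {0..t})"
        using t by (intro has_vector_derivative_within_subset[OF der]) auto
      then show "(g has_vector_derivative F (g s)) (at s within {0..t})"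
        using s t g(2) by (intro has_vector_derivative_transform[of s "{0..t}" g r]) auto
    qed (use t in auto)
    moreover have "g 0 = x0" using g(2)[of 0] T r by (simp add: ivp_solution_def)
    ultimately show "g t - integral {0..t} (\<lambda>t. F (g t)) = x0"
      by (simp add: integral_unique)
  qed
  have "(g has_vector_derivative F (g t)) (at t within {0..T})" if t: "t \<in> {0..T}" for t
  proof (rule has_vector_derivative_transform[OF t])
    show "((\<lambda>t. x0 + integral {0..t} (\<lambda>t. F (g t))) has_vector_derivative F (g t)) (at t within {0..T})"
      using has_vector_derivative_add[OF has_vector_derivative_const integral_has_vector_derivative[OF cFg t]]
      by simp
    show "g s = x0 + integral {0..s} (\<lambda>t. F (g t))" if "s \<in> {0..T}" for s
      using I[OF that] by (simp add: algebra_simps)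
  qed
  moreover have "{0..T} \<noteq> {0}" using T atLeastAtMost_singleton_iff[of 0 T 0] by simp
  ultimately have "ivp_solution F x0 {0..T} g"
    using T I[of 0] by (simp add: ivp_solution_def is_interval_cc)
  then show thesis using that g(2) by metis
qed

text \<open>A bounded interval of existence is [0,T] or [0,T), and neither is maximal: the first is
  prolonged by a global solution started at \<open>r T\<close>, the second is closed up at T because
  the solution stays bounded.\<close>

lemma maximal_solution_global:
  fixes F :: "'b::euclidean_space \<Rightarrow> 'b"
  assumes F: "continuous_on UNIV F" and "bounded K"
    and K: "\<And>I r. ivp_solution F x0 I r \<Longrightarrow> r ` I \<subseteq> K"
    and global: "\<And>x. x \<in> K \<Longrightarrow> \<exists>u. ivp_solution F x {0..} u"
    and max: "maximal_solution F x0 I r"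
  shows "I = {0..}"
proof (rule ccontr)
  assume neq: "I \<noteq> {0..}"
  have r: "ivp_solution F x0 I r"
    and ext: "\<And>I' r'. ivp_solution F x0 I' r' \<Longrightarrow> I \<subseteq> I' \<Longrightarrow> (\<And>t. t \<in> I \<Longrightarrow> r' t = r t) \<Longrightarrow> I' = I"
    using max unfolding maximal_solution_def by blast+
  have I: "is_interval I" "0 \<in> I" "I \<subseteq> {0..}" "I \<noteq> {0}" using r by (auto simp: ivp_solution_def)
  have mem: "t \<in> I" if "0 \<le> t" "t \<le> s" "s \<in> I" for s t
    using I(1) I(2) that unfolding is_interval_1 by blast
  have bdd: "bdd_above I"
  proof (rule ccontr)
    assume "\<not> bdd_above I"
    then have "\<exists>s\<in>I. t \<le> s" for t unfolding bdd_above_def by (meson linear)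
    then have "{0..} \<subseteq> I" using mem by (metis atLeast_iff subsetI)
    then show False using neq I by auto
  qed
  define T where "T = Sup I"
  have up: "t \<le> T" if "t \<in> I" for t using cSup_upper[OF that bdd] by (simp add: T_def)
  have lo: "t \<in> I" if "0 \<le> t" "t < T" for t
  proof -
    obtain s where "s \<in> I" "t < s" using less_cSupD[of I t] I(2) \<open>t < T\<close> by (auto simp: T_def)
    then show ?thesis using mem[of t s] that by simp
  qed
  obtain s where "s \<in> I" "s \<noteq> 0" using I(2,4) by blast
  then have T: "T > 0" using up[of s] I(3) by force
  show False
  proof (cases "T \<in> I")
    case True
    have IT: "I = {0..T}"
    proof (intro equalityI subsetI)
      show "t \<in> {0..T}" if "t \<in> I" for t using that up[OF that] I(3) by auto
      show "t \<in> I" if "t \<in> {0..T}" for t using that mem[of t T] True by simp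
    qed
    obtain u where u: "ivp_solution F (r T) {0..} u" using global K[OF r] True by blast
    have "{0..} = I"
      by (rule ext[OF ivp_solution_append[OF r[unfolded IT] u]]) (use IT in auto)
    then show False using neq by simp
  next
    case False
    have IT: "I = {0..<T}"
    proof (intro equalityI subsetI)
      show "t \<in> {0..<T}" if "t \<in> I" for t
        using that up[OF that] I(3) False by (cases "t = T") auto
      show "t \<in> I" if "t \<in> {0..<T}" for t using that lo[of t] by simp
    qed
    have "bounded (r ` I)" using K[OF r] \<open>bounded K\<close> bounded_subset by blast
    then obtain g where g: "ivp_solution F x0 {0..T} g" "\<And>t. t \<in> {0..<T} \<Longrightarrow> g t = r t"
      using ivp_solution_extend_closed[OF F r[unfolded IT]] IT by metis
    have "{0..T} = I" by (rule ext[OF g(1)]) (use IT g(2) in auto)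
    then show False using False T by auto
  qed
qed

section \<open>Convergence by a Lyapunov function\<close>

lemma ivp_solution_derivative_mono:
  fixes f :: "'b::real_inner \<Rightarrow> real"
  assumes f: "\<And>x. (f has_derivative (\<lambda>h. f' x \<bullet> h)) (at x)"
    and r: "ivp_solution F x0 I r" and I: "s \<in> I" "t \<in> I" "s \<le> t"
    and le: "\<And>\<tau>. s \<le> \<tau> \<Longrightarrow> \<tau> \<le> t \<Longrightarrow> f' (r \<tau>) \<bullet> F (r \<tau>) \<le> c"
  shows "f (r t) - f (r s) \<le> c * (t - s)"
proof -
  have sub: "{s..t} \<subseteq> I" using r I unfolding ivp_solution_def is_interval_1 by fastforce
  have "\<exists>\<tau>\<in>{s..t}. (f \<circ> r) t - (f \<circ> r) s = (\<lambda>h. h *\<^sub>R (f' (r \<tau>) \<bullet> F (r \<tau>))) (t - s)"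
  proof (rule mvt_very_simple[OF I(3)])
    fix \<tau> assume \<tau>: "s \<le> \<tau>" "\<tau> \<le> t"
    then have "(r has_vector_derivative F (r \<tau>)) (at \<tau> within {s..t})"
      using r sub unfolding ivp_solution_def
      by (meson atLeastAtMost_iff has_vector_derivative_within_subset subset_iff)
    moreover have "(f has_derivative (\<lambda>h. f' (r \<tau>) \<bullet> h)) (at (r \<tau>) within r ` {s..t})"
      by (rule has_derivative_at_withinI[OF f])
    ultimately show "((f \<circ> r) has_derivative (\<lambda>h. h *\<^sub>R (f' (r \<tau>) \<bullet> F (r \<tau>)))) (at \<tau> within {s..t})"
      unfolding has_vector_derivative_def[symmetric]
      by (rule vector_derivative_diff_chain_within)
  qed
  then obtain \<tau> where \<tau>: "\<tau> \<in> {s..t}" "f (r t) - f (r s) = (t - s) * (f' (r \<tau>) \<bullet> F (r \<tau>))" by auto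
  then show ?thesis
    using mult_left_mono[OF le[of \<tau>], of "t - s"] I(3) by (simp add: mult.commute)
qed

text \<open>On a compact part of the sublevel set that avoids l, \<open>f\<close> decreases at a
  rate bounded away from 0, so every solution reaches values arbitrarily close to
  \<open>f l\<close>; strict minimality turns small values of \<open>f\<close> into closeness to
  l.\<close>

theorem lyapunov_flow_converges:
  fixes F :: "'b::euclidean_space \<Rightarrow> 'b" and f :: "'b \<Rightarrow> real"
  assumes F: "continuous_on UNIV F"
    and f: "\<And>x. (f has_derivative (\<lambda>h. f' x \<bullet> h)) (at x)" and f': "continuous_on UNIV f'"
    and descent: "\<And>x. f' x \<bullet> F x \<le> 0" and conserved: "\<And>x. c \<bullet> F x = 0"
    and compact: "\<And>a. compact {x. c \<bullet> x = c \<bullet> x0 \<and> f x \<le> a}"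
    and l: "c \<bullet> l = c \<bullet> x0" "P l"
    and strict: "\<And>x. c \<bullet> x = c \<bullet> x0 \<Longrightarrow> x \<noteq> l \<Longrightarrow> f l < f x \<and> f' x \<bullet> F x < 0"
  shows "solutions_converge_to F x0 P"
proof -
  define K where "K = {x. c \<bullet> x = c \<bullet> x0 \<and> f x \<le> f x0}"
  have KK: "compact K" unfolding K_def by (rule compact)
  have cf: "continuous_on S f" for S
    by (rule has_derivative_continuous_on[of S f "\<lambda>x h. f' x \<bullet> h"]) (rule has_derivative_at_withinI[OF f])
  \<comment> \<open>A nonnegative scalar factor affects neither the conservation law nor the sign of
    the derivative of \<open>f\<close>. With the factor, the claim serves both the original field
    (factor 1) and the truncated one below.\<close>
  have invariant: "r ` I \<subseteq> {y. c \<bullet> y = c \<bullet> x \<and> f y \<le> f x}"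
    if r: "ivp_solution (\<lambda>y. \<phi> y *\<^sub>R F y) x I r" and \<phi>: "\<And>y. \<phi> y \<ge> 0" for \<phi> x I r
  proof safe
    fix t assume t: "t \<in> I"
    have I: "0 \<in> I" "0 \<le> t" and r0: "r 0 = x" using r t by (auto simp: ivp_solution_def)
    have "f (r t) - f (r 0) \<le> 0 * (t - 0)"
      by (rule ivp_solution_derivative_mono[OF f r I(1) t I(2)])
        (use \<phi> descent in \<open>simp add: mult_nonneg_nonpos\<close>)
    then show "f (r t) \<le> f x" using r0 by simp
    have lin: "((\<lambda>x. a \<bullet> x) has_derivative (\<lambda>h. a \<bullet> h)) (at y)" for a y :: 'b
      by (auto intro!: derivative_eq_intros)
    have "c \<bullet> r t - c \<bullet> r 0 \<le> 0 * (t - 0)"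
      by (rule ivp_solution_derivative_mono[OF lin r I(1) t I(2)]) (simp add: conserved)
    moreover have "(- c) \<bullet> r t - (- c) \<bullet> r 0 \<le> 0 * (t - 0)"
      by (rule ivp_solution_derivative_mono[OF lin r I(1) t I(2)]) (simp add: conserved)
    ultimately show "c \<bullet> r t = c \<bullet> x" using r0 by simp
  qed
  have inK: "r ` I \<subseteq> K" if "ivp_solution F x0 I r" for I r
    using invariant[of "\<lambda>_. 1" x0 I r] that by (simp add: K_def)
  have global: "\<exists>u. ivp_solution F x {0..} u" if "x \<in> K" for x
  proof -
    obtain R where R: "\<And>y. y \<in> K \<Longrightarrow> norm y \<le> R"
      using KK compact_imp_bounded bounded_iff by metis
    \<comment> \<open>Cutting off the vector field makes it bounded without affecting the Lyapunov property.\<close>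
    define \<phi> where "\<phi> y = max 0 (min 1 (R + 1 - norm y))" for y :: 'b
    have c\<phi>: "continuous_on UNIV (\<lambda>y. \<phi> y *\<^sub>R F y)"
      unfolding \<phi>_def by (intro continuous_intros F)
    then have "compact ((\<lambda>y. \<phi> y *\<^sub>R F y) ` cball 0 (R + 1))"
      by (intro compact_continuous_image) (auto intro: continuous_on_subset)
    then obtain M where M: "\<And>y. y \<in> cball 0 (R + 1) \<Longrightarrow> norm (\<phi> y *\<^sub>R F y) \<le> M"
      by (meson bounded_iff compact_imp_bounded imageI)
    have bd: "norm (\<phi> y *\<^sub>R F y) \<le> max 0 M" for y
    proof (cases "y \<in> cball 0 (R + 1)")
      case False
      then have "\<phi> y = 0" by (simp add: \<phi>_def)
      then show ?thesis by simp
    qed (use M in fastforce)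
    obtain u where u: "ivp_solution (\<lambda>y. \<phi> y *\<^sub>R F y) x {0..} u"
      using peano_bounded[OF c\<phi> bd] by blast
    have "u t \<in> K" if "t \<ge> 0" for t
      using invariant[OF u] that \<open>x \<in> K\<close> by (fastforce simp: \<phi>_def K_def)
    then have "\<phi> (u t) = 1" if "t \<ge> 0" for t
      using R that by (fastforce simp: \<phi>_def)
    then have "ivp_solution F x {0..} u"
      using u by (simp add: ivp_solution_def)
    then show ?thesis by blast
  qed
  have "x0 \<in> K" by (simp add: K_def)
  then obtain u where "ivp_solution F x0 {0..} u" using global by blast
  \<comment> \<open>Maximality is automatic, since domains of solutions are confined to
    \<open>{0..}\<close>.\<close>
  then have ex: "maximal_solution F x0 {0..} u"
    by (auto simp: maximal_solution_def) (auto simp: ivp_solution_def)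
  have "I = {0..} \<and> (\<exists>l. (r \<longlongrightarrow> l) at_top \<and> P l)" if max: "maximal_solution F x0 I r" for I r
  proof
    show I: "I = {0..}"
      by (rule maximal_solution_global[OF F compact_imp_bounded[OF KK] inK global max])
    have r: "ivp_solution F x0 {0..} r" using max I by (simp add: maximal_solution_def)
    have rK: "r t \<in> K" if "t \<ge> 0" for t using inK[OF r] that by auto
    have mono: "f (r t) \<le> f (r s)" if "0 \<le> s" "s \<le> t" for s t
      using ivp_solution_derivative_mono[OF f r, of s t 0] descent that by simp
    have level: "\<exists>t\<ge>0. f (r t) < f l + \<eta>" if \<eta>: "\<eta> > 0" for \<eta>
    proof (rule ccontr)
      assume "\<not> ?thesis"
      then have ge: "f (r t) \<ge> f l + \<eta>" if "t \<ge> 0" for t using that by force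
      define C where "C = K \<inter> f -` {f l + \<eta>..}"
      have C: "compact C"
        unfolding C_def using continuous_closed_preimage[OF cf closed_UNIV, of "{f l + \<eta>..}"] KK
        by (intro compact_Int_closed) auto
      have rC: "r t \<in> C" if "t \<ge> 0" for t using rK ge that by (simp add: C_def)
      have "continuous_on C (\<lambda>x. f' x \<bullet> F x)"
        by (intro continuous_intros continuous_on_subset[OF f'] continuous_on_subset[OF F]) auto
      then obtain y where y: "y \<in> C" "\<And>x. x \<in> C \<Longrightarrow> f' x \<bullet> F x \<le> f' y \<bullet> F y"
        using continuous_attains_sup[OF C] rC[of 0] by blast
      have "y \<noteq> l" using y(1) \<eta> by (auto simp: C_def)
      then have neg: "f' y \<bullet> F y < 0" using strict[of y] y(1) by (auto simp: C_def K_def)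
      \<comment> \<open>At the guaranteed rate of descent \<open>f\<close> is down to
        \<open>f l\<close> by this time, below the assumed floor
        \<open>f l + \<eta>\<close>.\<close>
      define t where "t = (f l - f x0) / (f' y \<bullet> F y)"
      have "f l \<le> f x0" using strict[of x0] by (cases "x0 = l") auto
      then have t: "t \<ge> 0" using neg by (simp add: t_def divide_nonpos_neg)
      have "f (r t) - f (r 0) \<le> (f' y \<bullet> F y) * (t - 0)"
        using t y(2) rC by (intro ivp_solution_derivative_mono[OF f r]) auto
      also have "\<dots> = f l - f x0" using neg by (simp add: t_def)
      also have "f x0 = f (r 0)" using r by (simp add: ivp_solution_def)
      finally show False using ge[OF t] \<eta> by simp
    qed
    have "(r \<longlongrightarrow> l) at_top"
    proof (rule tendstoI)
      fix \<epsilon> :: real assume \<epsilon>: "\<epsilon> > 0"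
      define N where "N = K - ball l \<epsilon>"
      have N: "compact N" unfolding N_def by (rule compact_diff[OF KK open_ball])
      \<comment> \<open>\<eta> is the gap between \<open>f l\<close> and the minimum of
        \<open>f\<close> on K outside the ball. As \<open>f\<close> never increases along the
        solution, one visit below \<open>f l + \<eta>\<close> traps it in the ball for good.\<close>
      obtain \<eta> where \<eta>: "\<eta> > 0" "\<And>x. x \<in> N \<Longrightarrow> f l + \<eta> \<le> f x"
      proof (cases "N = {}")
        case False
        then obtain y where y: "y \<in> N" "\<And>x. x \<in> N \<Longrightarrow> f y \<le> f x"
          using continuous_attains_inf[OF N False cf] by blast
        have "f l < f y" using strict[of y] y(1) \<epsilon> by (cases "y = l") (auto simp: N_def K_def)
        then show thesis using that[of "f y - f l"] y(2) by simp
      qed (use that[of 1] in auto)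
      obtain t0 where t0: "t0 \<ge> 0" "f (r t0) < f l + \<eta>" using level[OF \<eta>(1)] by blast
      have "dist (r t) l < \<epsilon>" if "t \<ge> t0" for t
      proof (rule ccontr)
        assume "\<not> ?thesis"
        then have "r t \<in> N" using rK[of t] t0 that by (auto simp: N_def dist_commute)
        then show False using \<eta>(2) mono[OF t0(1) that] t0(2) by force
      qed
      then show "\<forall>\<^sub>F t in at_top. dist (r t) l < \<epsilon>"
        unfolding eventually_at_top_linorder by blast
    qed
    then show "\<exists>l. (r \<longlongrightarrow> l) at_top \<and> P l" using l(2) by blast
  qed
  then show ?thesis using ex by (auto simp: solutions_converge_to_def)
qed

section \<open>Real powers of symmetric matrices\<close>

lemma symmetric_matrix_inner:
  fixes A :: "real ^ 'n ^ 'n"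
  assumes "transpose A = A"
  shows "(A *v x) \<bullet> y = x \<bullet> (A *v y)"
  by (metis assms dot_lmul_matrix transpose_matrix_vector)

text \<open>Take v maximising the Rayleigh quotient on the unit sphere of S. The residual w = A v -
  \<mu> v lies in S, and moving from v in the direction w would raise the quotient to first order
  unless w = 0.\<close>

lemma symmetric_eigenvector_in_subspace:
  fixes A :: "real ^ 'n ^ 'n"
  assumes A: "transpose A = A" and S: "subspace S" "S \<noteq> {0}" and inv: "\<And>x. x \<in> S \<Longrightarrow> A *v x \<in> S"
  obtains v \<mu> where "v \<in> S" "norm v = 1" "A *v v = \<mu> *\<^sub>R v"
proof -
  note sym = symmetric_matrix_inner[OF A]
  obtain x where x: "x \<in> S" "x \<noteq> 0" using S subspace_0 by blast
  have "compact (S \<inter> sphere 0 1)" by (intro closed_Int_compact closed_subspace S) auto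
  moreover have "sgn x \<in> S \<inter> sphere 0 1"
    using x S by (simp add: sgn_div_norm subspace_scale)
  moreover have "continuous_on (S \<inter> sphere 0 1) (\<lambda>x. x \<bullet> (A *v x))"
    by (intro continuous_intros linear_continuous_on) simp
  ultimately obtain v where v: "v \<in> S" "norm v = 1"
    and max: "\<And>y. y \<in> S \<Longrightarrow> norm y = 1 \<Longrightarrow> y \<bullet> (A *v y) \<le> v \<bullet> (A *v v)"
    using continuous_attains_sup[of "S \<inter> sphere 0 1" "\<lambda>x. x \<bullet> (A *v x)"] by fastforce
  define \<mu> where "\<mu> = v \<bullet> (A *v v)"
  have max': "y \<bullet> (A *v y) \<le> \<mu> * (y \<bullet> y)" if "y \<in> S" for y
  proof (cases "y = 0")
    case False
    have "sgn y \<bullet> (A *v sgn y) \<le> \<mu>"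
      using max[of "sgn y"] that S False
      by (simp add: \<mu>_def sgn_div_norm subspace_scale)
    moreover have "sgn y \<bullet> (A *v sgn y) = (y \<bullet> (A *v y)) / (norm y)\<^sup>2"
      by (simp add: sgn_div_norm matrix_vector_mult_scaleR power2_eq_square divide_inverse)
    ultimately show ?thesis using False
      by (simp add: divide_le_eq power2_norm_eq_inner)
  qed simp
  define w where "w = A *v v - \<mu> *\<^sub>R v"
  have wS: "w \<in> S" using v inv S by (simp add: w_def subspace_diff subspace_scale)
  have vv: "v \<bullet> v = 1" using v(2) by (simp add: norm_eq_1)
  have wAv: "w \<bullet> (A *v v) = w \<bullet> w + \<mu> * (v \<bullet> w)"
    by (simp add: w_def algebra_simps inner_commute)
  define C where "C = \<mu> * (w \<bullet> w) - w \<bullet> (A *v w)"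
  \<comment> \<open>After cancellation in \<open>max'\<close> at v + t w, a term linear in t is
    bounded by a quadratic one; this is that inequality divided by t.\<close>
  have first_variation: "2 * (w \<bullet> w) \<le> t * C" if t: "t > 0" for t
  proof -
    have "v + t *\<^sub>R w \<in> S" using v wS S by (simp add: subspace_add subspace_scale)
    from max'[OF this]
    moreover have "(v + t *\<^sub>R w) \<bullet> (A *v (v + t *\<^sub>R w)) =
        v \<bullet> (A *v v) + t * (v \<bullet> (A *v w)) + t * (w \<bullet> (A *v v)) + t * (t * (w \<bullet> (A *v w)))"
      by (simp only: matrix_vector_right_distrib matrix_vector_mult_scaleR inner_add_left
          inner_add_right inner_scaleR_left inner_scaleR_right distrib_left add.assoc add.left_commute)
    moreover have "(v + t *\<^sub>R w) \<bullet> (v + t *\<^sub>R w) = 1 + 2 * (t * (v \<bullet> w)) + t * (t * (w \<bullet> w))"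
      by (simp add: inner_add_left inner_add_right vv inner_commute[of w v] distrib_left)
    moreover have "v \<bullet> (A *v w) = w \<bullet> (A *v v)" by (metis sym inner_commute)
    ultimately have "\<mu> + 2 * (t * (w \<bullet> w + \<mu> * (v \<bullet> w))) + t * (t * (w \<bullet> (A *v w)))
        \<le> \<mu> * (1 + 2 * (t * (v \<bullet> w)) + t * (t * (w \<bullet> w)))"
      unfolding \<mu>_def[symmetric] by (simp only: wAv)
    then have "t * (2 * (w \<bullet> w)) \<le> t * (t * C)"
      unfolding C_def by (simp add: algebra_simps)
    then show ?thesis using t by simp
  qed
  have "w = 0"
  proof (rule ccontr)
    assume "w \<noteq> 0"
    then have w: "w \<bullet> w > 0" by simp
    define t where "t = (w \<bullet> w) / (\<bar>C\<bar> + 1)"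
    have "t > 0" using w by (simp add: t_def)
    then have "2 * (w \<bullet> w) \<le> t * \<bar>C\<bar>"
      using first_variation[of t] by (smt (verit) mult_left_mono)
    also have "\<dots> \<le> t * (\<bar>C\<bar> + 1)" using \<open>t > 0\<close> by simp
    also have "\<dots> = w \<bullet> w" by (simp add: t_def)
    finally show False using w by simp
  qed
  then have "A *v v = \<mu> *\<^sub>R v" by (simp add: w_def)
  then show thesis using that v by blast
qed

text \<open>Invariant subspaces are what the induction needs: by symmetry the orthogonal complement
  of an eigenvector within S is again invariant.\<close>

lemma symmetric_orthonormal_eigenbasis:
  fixes A :: "real ^ 'n ^ 'n"
  assumes A: "transpose A = A"
  shows "subspace S \<Longrightarrow> (\<And>x. x \<in> S \<Longrightarrow> A *v x \<in> S) \<Longrightarrow>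
    \<exists>B. B \<subseteq> S \<and> pairwise orthogonal B \<and> (\<forall>v\<in>B. norm v = 1 \<and> (\<exists>\<mu>. A *v v = \<mu> *\<^sub>R v)) \<and> span B = S"
proof (induction "dim S" arbitrary: S rule: less_induct)
  case less
  show ?case
  proof (cases "S = {0}")
    case True
    then show ?thesis by (intro exI[of _ "{}"]) simp
  next
    case False
    obtain v \<mu> where v: "v \<in> S" "norm v = 1" "A *v v = \<mu> *\<^sub>R v"
      using symmetric_eigenvector_in_subspace[OF A less(2) False less(3)] by blast
    define S' where "S' = {y \<in> S. v \<bullet> y = 0}"
    have vv: "v \<bullet> v = 1" using v(2) by (simp add: norm_eq_1)
    have S': "subspace S'"
      using less(2) by (auto simp: S'_def subspace_def inner_add_right)
    have "v \<notin> S'" by (simp add: S'_def vv)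
    then have "S' \<subset> S" using v(1) unfolding S'_def by blast
    then have "dim S' < dim S"
      using dim_psubset[of S' S] less(2) S' by (metis span_eq_iff)
    moreover have "A *v y \<in> S'" if "y \<in> S'" for y
      using that less(3) v(3) by (simp add: S'_def symmetric_matrix_inner[OF A, symmetric])
    ultimately obtain B where B: "B \<subseteq> S'" "pairwise orthogonal B"
      "\<forall>v\<in>B. norm v = 1 \<and> (\<exists>\<mu>. A *v v = \<mu> *\<^sub>R v)" "span B = S'"
      using less(1)[OF _ S'] by metis
    have "span (insert v B) = S"
    proof (rule span_unique)
      show "insert v B \<subseteq> S" "subspace S" using B v less(2) by (auto simp: S'_def)
      fix T assume T: "insert v B \<subseteq> T" "subspace T"
      show "S \<subseteq> T"
      proof
        fix y assume y: "y \<in> S"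
        have "y - (v \<bullet> y) *\<^sub>R v \<in> S'"
          using y v less(2) vv by (simp add: S'_def subspace_diff subspace_scale inner_diff_right)
        then have "y - (v \<bullet> y) *\<^sub>R v \<in> T" using B(4) T span_minimal[of B T] by auto
        then have "(y - (v \<bullet> y) *\<^sub>R v) + (v \<bullet> y) *\<^sub>R v \<in> T"
          using T by (intro subspace_add subspace_scale) auto
        then show "y \<in> T" by simp
      qed
    qed
    moreover have "pairwise orthogonal (insert v B)"
      using B(1,2) by (auto simp: pairwise_insert S'_def orthogonal_def inner_commute)
    ultimately show ?thesis
      using B v by (intro exI[of _ "insert v B"]) (auto simp: S'_def)
  qed
qed

text \<open>The pattern inside \<open>matrix_real_power\<close>. The rows of Q form an orthonormal
  eigenbasis, and \<open>Q *v x\<close> lists the coordinates of x in it.\<close>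

definition diagonalizes :: "real ^ 'n ^ 'n \<Rightarrow> real ^ 'n \<Rightarrow> real ^ 'n ^ 'n \<Rightarrow> bool" where
  "diagonalizes Q d A \<longleftrightarrow> orthogonal_matrix Q \<and> A = transpose Q ** diag_matrix d ** Q"

lemma diag_matrix_mult: "(diag_matrix d ** A) $ i $ j = d $ i * A $ i $ j"
  by (simp add: diag_matrix_def matrix_matrix_mult_def if_distrib[of "\<lambda>x. x * _"] cong: if_cong)

lemma mult_diag_matrix: "(A ** diag_matrix d) $ i $ j = A $ i $ j * d $ j"
  by (simp add: diag_matrix_def matrix_matrix_mult_def if_distrib[of "\<lambda>x. _ * x"] cong: if_cong)

lemma diag_matrix_vector_mult: "(diag_matrix d *v x) $ i = d $ i * x $ i"
  by (simp add: diag_matrix_def matrix_vector_mult_def if_distrib[of "\<lambda>x. x * _"] cong: if_cong)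

lemma transpose_diag_matrix: "transpose (diag_matrix d) = diag_matrix d"
  by (simp add: transpose_def diag_matrix_def vec_eq_iff)

theorem symmetric_diagonalizable:
  fixes A :: "real ^ 'n ^ 'n"
  assumes A: "transpose A = A"
  obtains Q d where "diagonalizes Q d A"
proof -
  obtain B :: "(real ^ 'n) set" where B: "pairwise orthogonal B"
    "\<forall>v\<in>B. norm v = 1 \<and> (\<exists>\<mu>. A *v v = \<mu> *\<^sub>R v)" "span B = UNIV"
    using symmetric_orthonormal_eigenbasis[OF A, of UNIV] by auto
  have "independent B" using B by (intro pairwise_orthogonal_independent) auto
  then have "card B = DIM(real ^ 'n)" "finite B"
    using B(3) by (metis dim_UNIV dim_eq_card dim_span_eq_card_independent)
      (use \<open>independent B\<close> independent_imp_finite in blast)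
  then obtain b :: "'n \<Rightarrow> real ^ 'n" where b: "bij_betw b UNIV B"
    using finite_same_card_bij[of "UNIV :: 'n set" B] by auto
  have bB: "b i \<in> B" for i using b bij_betwE by blast
  then have "\<forall>i. \<exists>\<mu>. A *v b i = \<mu> *\<^sub>R b i" using B(2) by blast
  from choice[OF this] obtain \<mu> where \<mu>: "\<And>i. A *v b i = \<mu> i *\<^sub>R b i" by blast
  define Q :: "real ^ 'n ^ 'n" where "Q = (\<chi> i. b i)"
  define d :: "real ^ 'n" where "d = (\<chi> i. \<mu> i)"
  have row: "row i Q = b i" for i by (simp add: row_def Q_def vec_nth_inverse)
  have orth: "orthogonal (b i) (b j)" if "i \<noteq> j" for i j
    using B(1) bB that b unfolding pairwise_def bij_betw_def inj_def by metis
  have "norm (b i) = 1" for i using B(2) bB[of i] by simp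
  then have Q: "orthogonal_matrix Q"
    unfolding orthogonal_matrix_orthonormal_rows row using orth by simp
  have "(Q ** A) $ i = (diag_matrix d ** Q) $ i" for i
  proof -
    have "(Q ** A) $ i = transpose A *v b i"
      by (simp add: vec_eq_iff matrix_matrix_mult_def vector_matrix_mult_def Q_def)
    also have "\<dots> = (diag_matrix d ** Q) $ i"
      by (simp add: A \<mu> vec_eq_iff diag_matrix_mult Q_def d_def del: transpose_matrix_vector)
    finally show ?thesis .
  qed
  then have "Q ** A = diag_matrix d ** Q" by (simp add: vec_eq_iff)
  then have "transpose Q ** diag_matrix d ** Q = transpose Q ** Q ** A"
    by (simp add: matrix_mul_assoc[symmetric])
  also have "\<dots> = A" using Q by (simp add: orthogonal_matrix_def)
  finally show thesis by (intro that[of Q d]) (simp add: diagonalizes_def Q)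
qed

lemma diagonalizes_mult_vec:
  assumes "diagonalizes Q d A"
  shows "(Q *v (A *v x)) $ i = d $ i * (Q *v x) $ i"
proof -
  have "Q *v (A *v x) = (Q ** transpose Q) *v (diag_matrix d *v (Q *v x))"
    using assms by (simp add: diagonalizes_def matrix_vector_mul_assoc matrix_mul_assoc)
  then show ?thesis
    using assms by (simp add: diagonalizes_def orthogonal_matrix_def diag_matrix_vector_mult)
qed

lemma orthogonal_matrix_eq_iff:
  assumes "orthogonal_matrix Q"
  shows "Q *v x = Q *v y \<longleftrightarrow> x = y"
  by (metis assms matrix_vector_mul_assoc matrix_vector_mul_lid orthogonal_matrix_def)

lemma diagonalizes_inner:
  assumes "diagonalizes Q d A"
  shows "x \<bullet> (A *v y) = (\<Sum>i\<in>UNIV. d $ i * (Q *v x) $ i * (Q *v y) $ i)"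
proof -
  have "x \<bullet> (A *v y) = x \<bullet> (transpose Q *v (diag_matrix d *v (Q *v y)))"
    using assms by (simp add: diagonalizes_def matrix_vector_mul_assoc matrix_mul_assoc
        del: transpose_matrix_vector)
  also have "\<dots> = (Q *v x) \<bullet> (diag_matrix d *v (Q *v y))"
    by (metis dot_lmul_matrix vector_transpose_matrix)
  finally show ?thesis by (simp add: inner_vec_def diag_matrix_vector_mult mult_ac)
qed

lemma diagonalizes_symmetric: "diagonalizes Q d A \<Longrightarrow> transpose A = A"
  by (simp add: diagonalizes_def matrix_transpose_mul transpose_diag_matrix matrix_mul_assoc)

lemma diagonalizes_eigenvalue:
  assumes "diagonalizes Q d A"
  obtains x where "x \<noteq> 0" "x \<bullet> (A *v x) = d $ i"
proof
  have Q: "Q *v (transpose Q *v axis i 1) = axis i 1"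
    using assms by (simp add: diagonalizes_def orthogonal_matrix_def matrix_vector_mul_assoc
        del: transpose_matrix_vector)
  then show "transpose Q *v axis i 1 \<noteq> 0"
    by (metis axis_eq_0_iff matrix_vector_mult_0_right zero_neq_one)
  show "(transpose Q *v axis i 1) \<bullet> (A *v (transpose Q *v axis i 1)) = d $ i"
    unfolding diagonalizes_inner[OF assms] Q by (simp add: axis_def if_distrib cong: if_cong)
qed

text \<open>Exhibits the eigenvalues as continuous functions of Q and A, so that they converge
  whenever Q and A do.\<close>

lemma diagonalizes_diagonal_entry:
  assumes "diagonalizes Q d A"
  shows "(Q ** A ** transpose Q) $ i $ i = d $ i"
proof -
  have "Q ** A ** transpose Q = (Q ** transpose Q) ** diag_matrix d ** (Q ** transpose Q)"
    using assms by (simp add: diagonalizes_def matrix_mul_assoc)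
  also have "\<dots> = diag_matrix d"
    using assms by (simp add: diagonalizes_def orthogonal_matrix_def)
  finally show ?thesis by (simp add: diag_matrix_def)
qed

text \<open>The definite description is legitimate: two diagonalizations of A are related by P = Q
  Q'^T with D P = P D'. Entrywise, P vanishes wherever the eigenvalues differ, so it also
  intertwines any function of them, in particular the s-th powers.\<close>

lemma matrix_real_power_eq:
  assumes "diagonalizes Q d A"
  shows "matrix_real_power A s = transpose Q ** diag_matrix (\<chi> i. d $ i powr s) ** Q"
proof -
  have unique: "transpose Q ** diag_matrix (\<chi> i. d $ i powr s) ** Q =
      transpose Q' ** diag_matrix (\<chi> i. d' $ i powr s) ** Q'"
    if Q: "orthogonal_matrix Q" and Q': "orthogonal_matrix Q'"
      and eq: "transpose Q ** diag_matrix d ** Q = transpose Q' ** diag_matrix d' ** Q'"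
    for Q Q' :: "real ^ 'n ^ 'n" and d d' :: "real ^ 'n"
  proof -
    define P where "P = Q ** transpose Q'"
    have "diag_matrix d ** P = Q ** (transpose Q ** diag_matrix d ** Q) ** transpose Q'"
      using Q by (simp add: P_def matrix_mul_assoc orthogonal_matrix_def)
    also have "\<dots> = P ** diag_matrix d'"
      unfolding eq using Q' by (simp add: P_def matrix_mul_assoc[symmetric] orthogonal_matrix_def)
    finally have "d $ i * P $ i $ j = P $ i $ j * d' $ j" for i j
      by (metis diag_matrix_mult mult_diag_matrix)
    then have P: "P $ i $ j = 0 \<or> d $ i = d' $ j" for i j
      by (metis mult.commute mult_left_cancel)
    have "diag_matrix (\<chi> i. d $ i powr s) ** P = P ** diag_matrix (\<chi> i. d' $ i powr s)"
      unfolding vec_eq_iff diag_matrix_mult mult_diag_matrix using P by fastforce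
    then have "transpose Q ** (diag_matrix (\<chi> i. d $ i powr s) ** P) ** Q' =
        transpose Q ** (P ** diag_matrix (\<chi> i. d' $ i powr s)) ** Q'" by simp
    moreover have "transpose Q ** (diag_matrix (\<chi> i. d $ i powr s) ** P) ** Q' =
        transpose Q ** diag_matrix (\<chi> i. d $ i powr s) ** Q ** (transpose Q' ** Q')"
      by (simp add: P_def matrix_mul_assoc)
    moreover have "transpose Q ** (P ** diag_matrix (\<chi> i. d' $ i powr s)) ** Q' =
        (transpose Q ** Q) ** transpose Q' ** diag_matrix (\<chi> i. d' $ i powr s) ** Q'"
      by (simp add: P_def matrix_mul_assoc)
    ultimately show ?thesis using Q Q' by (simp add: orthogonal_matrix_def)
  qed
  show ?thesis
    unfolding matrix_real_power_def
  proof (rule the_equality)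
    show "\<exists>Q' d'. orthogonal_matrix Q' \<and> A = transpose Q' ** diag_matrix d' ** Q' \<and>
      transpose Q ** diag_matrix (\<chi> i. d $ i powr s) ** Q =
      transpose Q' ** diag_matrix (\<chi> i. d' $ i powr s) ** Q'"
      using assms by (auto simp: diagonalizes_def)
    fix B assume "\<exists>Q d. orthogonal_matrix Q \<and> A = transpose Q ** diag_matrix d ** Q \<and>
      B = transpose Q ** diag_matrix (\<chi> i. d $ i powr s) ** Q"
    then show "B = transpose Q ** diag_matrix (\<chi> i. d $ i powr s) ** Q"
      using assms unique unfolding diagonalizes_def by metis
  qed
qed

lemma diagonalizes_matrix_real_power:
  "diagonalizes Q d A \<Longrightarrow> diagonalizes Q (\<chi> i. d $ i powr s) (matrix_real_power A s)"
  by (simp add: diagonalizes_def[of _ _ "matrix_real_power A s"] matrix_real_power_eq)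
    (simp add: diagonalizes_def)

section \<open>Continuity of real powers on positive definite matrices\<close>

lemma tendsto_matrix_mult:
  fixes f :: "'a \<Rightarrow> real ^ 'n ^ 'm" and g :: "'a \<Rightarrow> real ^ 'k ^ 'n"
  assumes "(f \<longlongrightarrow> A) F" "(g \<longlongrightarrow> B) F"
  shows "((\<lambda>x. f x ** g x) \<longlongrightarrow> A ** B) F"
  unfolding matrix_matrix_mult_def by (intro tendsto_intros assms)

lemma tendsto_transpose:
  fixes f :: "'a \<Rightarrow> real ^ 'n ^ 'm"
  assumes "(f \<longlongrightarrow> A) F"
  shows "((\<lambda>x. transpose (f x)) \<longlongrightarrow> transpose A) F"
  unfolding transpose_def by (intro tendsto_intros assms)

lemma compact_orthogonal_matrices: "compact {Q :: real ^ 'n ^ 'n. orthogonal_matrix Q}"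
  unfolding compact_eq_bounded_closed
proof
  have "norm Q \<le> real CARD('n)" if "orthogonal_matrix Q" for Q :: "real ^ 'n ^ 'n"
  proof -
    have "norm Q \<le> (\<Sum>i\<in>UNIV. norm (Q $ i))"
      unfolding norm_vec_def[of Q] by (rule L2_set_le_sum) simp
    also have "\<dots> = real CARD('n)"
      using that by (simp add: orthogonal_matrix_orthonormal_rows row_def vec_nth_inverse)
    finally show ?thesis .
  qed
  then show "bounded {Q :: real ^ 'n ^ 'n. orthogonal_matrix Q}" by (auto simp: bounded_iff)
  show "closed {Q :: real ^ 'n ^ 'n. orthogonal_matrix Q}"
    unfolding closed_sequential_limits mem_Collect_eq
  proof safe
    fix q :: "nat \<Rightarrow> real ^ 'n ^ 'n" and Q assume q: "\<forall>n. orthogonal_matrix (q n)" "q \<longlonglongrightarrow> Q"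
    have "(\<lambda>n. transpose (q n) ** q n) \<longlonglongrightarrow> transpose Q ** Q"
      by (intro tendsto_matrix_mult tendsto_transpose q)
    then show "orthogonal_matrix Q"
      using q(1) by (simp add: orthogonal_matrix LIMSEQ_const_iff)
  qed
qed

text \<open>Eigenvectors need not vary continuously where eigenvalues coincide, so no
  diagonalization is followed along the sequence. Instead, compactness of the orthogonal group gives
  a convergent subsequence of diagonalizing matrices. Its limit diagonalizes A, and the power does
  not depend on which diagonalization arises.\<close>

theorem continuous_on_matrix_real_power:
  "continuous_on {A :: real ^ 'n ^ 'n. transpose A = A \<and> (\<forall>x. x \<noteq> 0 \<longrightarrow> x \<bullet> (A *v x) > 0)}
    (\<lambda>A. matrix_real_power A s)" (is "continuous_on ?S _")
proof (rule continuous_on_sequentiallyI)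
  fix u and A :: "real ^ 'n ^ 'n"
  assume u: "\<forall>n. u n \<in> ?S" and A: "A \<in> ?S" and lim: "u \<longlonglongrightarrow> A"
  show "(\<lambda>n. matrix_real_power (u n) s) \<longlonglongrightarrow> matrix_real_power A s"
  proof (rule ccontr)
    assume "\<not> ?thesis"
    then obtain \<epsilon> where \<epsilon>: "\<epsilon> > 0"
      "\<not> (\<forall>\<^sub>F n in sequentially. dist (matrix_real_power (u n) s) (matrix_real_power A s) < \<epsilon>)"
      by (auto simp: tendsto_iff)
    then obtain \<rho> :: "nat \<Rightarrow> nat" where \<rho>: "strict_mono \<rho>"
      "\<And>n. \<not> dist (matrix_real_power (u (\<rho> n)) s) (matrix_real_power A s) < \<epsilon>"
      using not_eventually_sequentiallyD[OF \<epsilon>(2)] by blast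
    have "\<exists>Q d. diagonalizes Q d (u (\<rho> n))" for n
      using u symmetric_diagonalizable by (metis (mono_tags, lifting) mem_Collect_eq)
    then obtain Q d where Qd: "\<And>n. diagonalizes (Q n) (d n) (u (\<rho> n))" by metis
    have "\<forall>n. Q n \<in> {Q. orthogonal_matrix Q}" using Qd by (simp add: diagonalizes_def)
    then obtain Q' \<sigma> where \<sigma>: "orthogonal_matrix Q'" "strict_mono \<sigma>" "(Q \<circ> \<sigma>) \<longlonglongrightarrow> Q'"
      using compact_orthogonal_matrices unfolding compact_def by blast
    have Qlim: "(\<lambda>n. Q (\<sigma> n)) \<longlonglongrightarrow> Q'" using \<sigma>(3) by (simp add: o_def)
    have ulim: "(\<lambda>n. u (\<rho> (\<sigma> n))) \<longlonglongrightarrow> A"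
      using LIMSEQ_subseq_LIMSEQ[OF LIMSEQ_subseq_LIMSEQ[OF lim \<rho>(1)] \<sigma>(2)] by (simp add: o_def)
    define d' where "d' = (\<chi> i. (Q' ** A ** transpose Q') $ i $ i)"
    have dlim: "(\<lambda>n. d (\<sigma> n) $ i) \<longlonglongrightarrow> d' $ i" for i
    proof -
      have "(\<lambda>n. (Q (\<sigma> n) ** u (\<rho> (\<sigma> n)) ** transpose (Q (\<sigma> n))) $ i $ i) \<longlonglongrightarrow> d' $ i"
        unfolding d'_def vec_lambda_beta
        by (intro tendsto_vec_nth tendsto_matrix_mult tendsto_transpose Qlim ulim)
      then show ?thesis by (simp add: diagonalizes_diagonal_entry[OF Qd])
    qed
    have dmat: "(\<lambda>n. diag_matrix (c n)) \<longlonglongrightarrow> diag_matrix c'"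
      if "\<And>i. (\<lambda>n. c n $ i) \<longlonglongrightarrow> c' $ i" for c :: "nat \<Rightarrow> real ^ 'n" and c'
      unfolding diag_matrix_def by (intro tendsto_vec_lambda) (simp add: that)
    have "(\<lambda>n. transpose (Q (\<sigma> n)) ** diag_matrix (d (\<sigma> n)) ** Q (\<sigma> n)) \<longlonglongrightarrow>
        transpose Q' ** diag_matrix d' ** Q'"
      by (intro tendsto_matrix_mult tendsto_transpose Qlim dmat dlim)
    then have "(\<lambda>n. u (\<rho> (\<sigma> n))) \<longlonglongrightarrow> transpose Q' ** diag_matrix d' ** Q'"
      using Qd by (simp add: diagonalizes_def)
    then have "A = transpose Q' ** diag_matrix d' ** Q'" using LIMSEQ_unique ulim by blast
    then have Q'd': "diagonalizes Q' d' A" using \<sigma>(1) unfolding diagonalizes_def by blast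
    \<comment> \<open>Definiteness of the limit enters here: \<open>powr s\<close> is continuous at
      positive eigenvalues, but for s \<le> 0 not at 0.\<close>
    have pos: "d' $ i > 0" for i
      using A by (metis (mono_tags, lifting) diagonalizes_eigenvalue[OF Q'd', of i] mem_Collect_eq)
    have "(\<lambda>n. transpose (Q (\<sigma> n)) ** diag_matrix (\<chi> i. d (\<sigma> n) $ i powr s) ** Q (\<sigma> n)) \<longlonglongrightarrow>
        transpose Q' ** diag_matrix (\<chi> i. d' $ i powr s) ** Q'"
    proof (intro tendsto_matrix_mult tendsto_transpose Qlim dmat)
      fix i show "(\<lambda>n. (\<chi> i. d (\<sigma> n) $ i powr s) $ i) \<longlonglongrightarrow> (\<chi> i. d' $ i powr s) $ i"
        using pos[of i] by (auto intro!: tendsto_intros dlim)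
    qed
    then have "(\<lambda>n. matrix_real_power (u (\<rho> (\<sigma> n))) s) \<longlonglongrightarrow> matrix_real_power A s"
      by (simp add: matrix_real_power_eq[OF Qd] matrix_real_power_eq[OF Q'd'])
    then show False
      using \<rho>(2) \<epsilon>(1) by (metis lim_sequentially order_refl)
  qed
qed

section \<open>Kernel, positivity and rank-one correction of real powers\<close>

lemma diagonalizesI:
  assumes Q: "orthogonal_matrix Q" and d: "\<And>x i. (Q *v (A *v x)) $ i = d $ i * (Q *v x) $ i"
  shows "diagonalizes Q d A"
proof -
  have "Q *v (A *v x) = Q *v ((transpose Q ** diag_matrix d ** Q) *v x)" for x
  proof -
    have "Q *v ((transpose Q ** diag_matrix d ** Q) *v x) =
        (Q ** transpose Q) *v (diag_matrix d *v (Q *v x))"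
      by (simp only: matrix_vector_mul_assoc matrix_mul_assoc)
    also have "\<dots> = diag_matrix d *v (Q *v x)"
      using Q by (simp add: orthogonal_matrix_def)
    finally show ?thesis by (simp add: vec_eq_iff d diag_matrix_vector_mult)
  qed
  then show ?thesis
    using Q by (simp add: diagonalizes_def orthogonal_matrix_eq_iff matrix_eq)
qed

lemma diagonalizes_unique:
  "diagonalizes Q d A \<Longrightarrow> diagonalizes Q d B \<Longrightarrow> A = B"
  by (simp add: diagonalizes_def)

text \<open>In eigencoordinates x is supported where the eigenvalue is 0, and there
  \<open>0 powr s = 0\<close> for every s. Through this convention the fractional flow conserves the
  sum of the coordinates.\<close>

lemma matrix_real_power_kernel:
  assumes A: "transpose A = A" and "A *v x = 0"
  shows "matrix_real_power A s *v x = 0"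
proof -
  obtain Q d where Qd: "diagonalizes Q d A" using symmetric_diagonalizable[OF A] .
  have "d $ i = 0 \<or> (Q *v x) $ i = 0" for i
    using diagonalizes_mult_vec[OF Qd, of x i] assms by simp
  then have "Q *v (matrix_real_power A s *v x) = Q *v 0"
    using diagonalizes_mult_vec[OF diagonalizes_matrix_real_power[OF Qd]]
    by (fastforce simp: vec_eq_iff)
  then show ?thesis using Qd orthogonal_matrix_eq_iff diagonalizes_def by metis
qed

lemma transpose_matrix_real_power:
  "transpose A = A \<Longrightarrow> transpose (matrix_real_power A s) = matrix_real_power A s"
  by (metis diagonalizes_matrix_real_power diagonalizes_symmetric symmetric_diagonalizable)

text \<open>\<open>powr\<close> is 0 at 0 and an exponential elsewhere, so the eigenvalues of the
  power are nonnegative whatever the signs of those of A.\<close>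

lemma matrix_real_power_inner_nonneg:
  assumes "transpose A = A"
  shows "x \<bullet> (matrix_real_power A s *v x) \<ge> 0"
proof -
  obtain Q d where Qd: "diagonalizes Q d A" using symmetric_diagonalizable[OF assms] .
  show ?thesis
    unfolding diagonalizes_inner[OF diagonalizes_matrix_real_power[OF Qd]]
    by (auto intro!: sum_nonneg simp: mult.assoc)
qed

lemma matrix_real_power_inner_pos:
  assumes A: "transpose A = A" and Ax: "A *v x \<noteq> 0"
  shows "x \<bullet> (matrix_real_power A s *v x) > 0"
proof -
  obtain Q d where Qd: "diagonalizes Q d A" using symmetric_diagonalizable[OF A] .
  have "Q *v (A *v x) \<noteq> Q *v 0"
    using Ax Qd orthogonal_matrix_eq_iff diagonalizes_def by metis
  then obtain i where "d $ i * (Q *v x) $ i \<noteq> 0"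
    by (auto simp: vec_eq_iff diagonalizes_mult_vec[OF Qd])
  then show ?thesis
    unfolding diagonalizes_inner[OF diagonalizes_matrix_real_power[OF Qd]]
    by (intro sum_pos2[of _ i]) (auto simp: mult.assoc zero_less_mult_iff linorder_neq_iff)
qed

definition rank_one :: "real ^ 'n \<Rightarrow> real ^ 'n ^ 'n" where
  "rank_one u = (\<chi> i j. u $ i * u $ j)"

lemma rank_one_mult_vec: "rank_one u *v x = (u \<bullet> x) *\<^sub>R u"
  by (simp add: rank_one_def matrix_vector_mult_def inner_vec_def vec_eq_iff sum_distrib_left mult_ac)

text \<open>Adding the projection onto the kernel turns a semi-definite matrix into a definite one;
  this reduces continuity of \<open>A\<^sup>s\<close> along matrices with a fixed kernel to the definite case.\<close>

lemma matrix_real_power_add_kernel_projection: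
  assumes A: "transpose A = A" and u: "norm u = 1" "A *v u = 0"
    and ker: "\<And>x. A *v x = 0 \<Longrightarrow> \<exists>c. x = c *\<^sub>R u"
  shows "matrix_real_power (A + rank_one u) s = matrix_real_power A s + rank_one u"
proof -
  obtain Q d where Qd: "diagonalizes Q d A" using symmetric_diagonalizable[OF A] .
  then have Q: "orthogonal_matrix Q" by (simp add: diagonalizes_def)
  define q where "q = Q *v u"
  have inner_Q: "(Q *v x) \<bullet> (Q *v y) = x \<bullet> y" for x y
    using Q by (metis dot_lmul_matrix matrix_vector_mul_assoc matrix_vector_mul_lid
        orthogonal_matrix_def vector_transpose_matrix)
  have qq: "q \<bullet> q = 1" using inner_Q u by (simp add: q_def norm_eq_1)
  have dq: "d $ i = 0 \<or> q $ i = 0" for i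
    using diagonalizes_mult_vec[OF Qd, of u i] u by (simp add: q_def)
  have axis_q: "\<exists>c. axis i 1 = c *\<^sub>R q" if "d $ i = 0" for i
  proof -
    have Qx: "Q *v (transpose Q *v axis i 1) = axis i 1"
      using Q by (simp add: orthogonal_matrix_def matrix_vector_mul_assoc
        del: transpose_matrix_vector)
    have "Q *v (A *v (transpose Q *v axis i 1)) = Q *v 0"
      unfolding vec_eq_iff diagonalizes_mult_vec[OF Qd] Qx using that by (simp add: axis_def)
    then have "A *v (transpose Q *v axis i 1) = 0" by (simp only: orthogonal_matrix_eq_iff[OF Q])
    then obtain c where "transpose Q *v axis i 1 = c *\<^sub>R u" using ker by blast
    then show ?thesis using Qx by (metis matrix_vector_mult_scaleR q_def)
  qed
  \<comment> \<open>The kernel is a line, so exactly one eigenvalue vanishes, at k, and u is plus or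
    minus the k-th row of Q. Hence \<open>rank_one u\<close> is diagonal in the same basis.\<close>
  obtain k where k: "q $ k \<noteq> 0" using qq by (metis inner_zero_left vec_eq_iff zero_index zero_neq_one)
  then have dk: "d $ k = 0" using dq by blast
  obtain c where c: "axis k 1 = c *\<^sub>R q" using axis_q[OF dk] by blast
  have "c \<noteq> 0" using c by (metis axis_eq_0_iff scaleR_zero_left zero_neq_one)
  then have q0: "q $ i = 0" if "i \<noteq> k" for i
    using c that by (auto simp: vec_eq_iff axis_def split: if_splits dest!: spec[of _ i])
  have qk: "q $ k * q $ k = 1"
  proof -
    have "q \<bullet> q = (\<Sum>i\<in>UNIV. if i = k then q $ k * q $ k else 0)"
      unfolding inner_vec_def using q0 by (intro sum.cong) auto
    then show ?thesis using qq by simp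
  qed
  have dne: "d $ i \<noteq> 0" if "i \<noteq> k" for i
  proof
    assume "d $ i = 0"
    then obtain c' where c': "axis i 1 = c' *\<^sub>R q" using axis_q by blast
    then have "(1::real) = c' * q $ i" by (metis axis_nth vector_scaleR_component real_scaleR_def)
    then show False using q0[OF that] by simp
  qed
  have P: "(Q *v (rank_one u *v x)) $ i = (if i = k then 1 else 0) * (Q *v x) $ i" for x i
  proof -
    have "u \<bullet> x = q \<bullet> (Q *v x)" by (simp add: q_def inner_Q)
    also have "\<dots> = (\<Sum>i\<in>UNIV. if i = k then q $ k * (Q *v x) $ k else 0)"
      unfolding inner_vec_def using q0 by (intro sum.cong) auto
    finally have "u \<bullet> x = q $ k * (Q *v x) $ k" by simp
    then show ?thesis
      using q0[of i] qk by (simp add: rank_one_mult_vec matrix_vector_mult_scaleR q_def[symmetric] mult_ac)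
  qed
  let ?e = "\<lambda>i. if i = k then 1 else 0 :: real"
  have "diagonalizes Q (\<chi> i. d $ i + ?e i) (A + rank_one u)"
    by (rule diagonalizesI[OF Q])
      (simp add: matrix_vector_mult_add_rdistrib matrix_vector_right_distrib P diagonalizes_mult_vec[OF Qd] distrib_right)
  from diagonalizes_matrix_real_power[OF this, of s]
  have 1: "diagonalizes Q (\<chi> i. (d $ i + ?e i) powr s) (matrix_real_power (A + rank_one u) s)"
    by simp
  \<comment> \<open>At k the two sides are (0 + 1)^s and 0^s + 1, both equal to 1; elsewhere nothing
    is added.\<close>
  have "(\<chi> i. (d $ i + ?e i) powr s) = (\<chi> i. d $ i powr s + ?e i)"
    using dk by (simp add: vec_eq_iff)
  moreover have "diagonalizes Q (\<chi> i. d $ i powr s + ?e i) (matrix_real_power A s + rank_one u)"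
    by (rule diagonalizesI[OF Q])
      (simp add: matrix_vector_mult_add_rdistrib matrix_vector_right_distrib P
        diagonalizes_mult_vec[OF diagonalizes_matrix_real_power[OF Qd]] distrib_right)
  ultimately show ?thesis using diagonalizes_unique 1 by metis
qed

section \<open>Edge shares and the curvature Jacobian\<close>

locale enumerated_graph =
  fixes V :: "'v set" and E :: "'v set set" and e :: "'n::finite \<Rightarrow> 'v set"
  assumes simple: "finite_simple_graph V E" and connected: "connected_graph V E"
    and enum: "bij_betw e UNIV E"
begin

lemma finite_V [simp]: "finite V"
  using simple by (simp add: finite_simple_graph_def)

lemma edge: "e i \<subseteq> V" "card (e i) = 2"
  using simple bij_betwE[OF enum] by (auto simp: finite_simple_graph_def)

lemma ex_edge: "f \<in> E \<Longrightarrow> \<exists>i. e i = f"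
  using enum by (metis bij_betw_imp_surj_on imageE)

lemma card_E: "card E = CARD('n)"
  using bij_betw_same_card[OF enum] by simp

lemma card_V_pos: "card V > 0"
  using connected by (auto simp: connected_graph_def card_gt_0_iff)

section \<open>Connectedness in terms of edges\<close>

lemma reachable_induct [consumes 2, case_names base step]:
  assumes "x \<in> V" "y \<in> V" "P x" "\<And>i u v. u \<in> e i \<Longrightarrow> v \<in> e i \<Longrightarrow> P u \<Longrightarrow> P v"
  shows "P y"
proof -
  have "(x, y) \<in> {(u, v). {u, v} \<in> E}\<^sup>*"
    using assms(1,2) connected by (auto simp: connected_graph_def)
  then show ?thesis
  proof (induction rule: rtrancl_induct)
    case (step u v)
    then obtain i where "e i = {u, v}" using ex_edge by auto
    then show ?case using assms(4)[of u i v] step by simp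
  qed (rule assms(3))
qed

lemma ex_incident:
  assumes "x \<in> V"
  shows "\<exists>i. x \<in> e i"
proof (rule ccontr)
  assume no: "\<nexists>i. x \<in> e i"
  \<comment> \<open>Index types are nonempty, so \<open>undefined\<close> names some edge; its
    endpoint y would be unreachable from an isolated x.\<close>
  obtain y where y: "y \<in> e undefined" using edge(2)[of undefined] by fastforce
  then have "y \<in> V" using edge by auto
  from assms this have "y = x"
    by (induction rule: reachable_induct) (use no in auto)
  then show False using y no by blast
qed

text \<open>Connectedness of the line graph. The induction runs over vertices and carries the claim
  that all edges at the current vertex have the value at i.\<close>

lemma constant_if_locally_constant:
  assumes "\<And>i j x. x \<in> e i \<Longrightarrow> x \<in> e j \<Longrightarrow> g i = g j"
  shows "g i = g j"
proof -
  obtain x y where xy: "x \<in> e i" "y \<in> e j" using edge(2)[of i] edge(2)[of j] by fastforce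
  then have "x \<in> V" "y \<in> V" using edge by auto
  then have "\<forall>k. y \<in> e k \<longrightarrow> g k = g i"
    by (induction rule: reachable_induct) (use xy assms in metis)+
  then show ?thesis using xy by simp
qed

section \<open>Shares of the mass at a vertex\<close>

lemma mass_pos: "x \<in> V \<Longrightarrow> vertex_mass e r x > 0"
  using ex_incident[of x] by (auto simp: vertex_mass_def edge_weight_def intro!: sum_pos)

text \<open>A softmax over the edges at x. The extension by 0 to the other edges lets sums range
  over all indices and over V, so that exchanging them is a plain swap.\<close>

definition share :: "real ^ 'n \<Rightarrow> 'v \<Rightarrow> 'n \<Rightarrow> real" where
  "share r x i = (if x \<in> e i then exp (r $ i) / vertex_mass e r x else 0)"

lemma share_nonneg: "share r x i \<ge> 0"
  unfolding share_def vertex_mass_def edge_weight_def by (simp add: sum_nonneg)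

lemma share_pos: "x \<in> e i \<Longrightarrow> share r x i > 0"
  using mass_pos[of x r] edge(1)[of i] by (auto simp: share_def)

lemma sum_share: "x \<in> V \<Longrightarrow> (\<Sum>i\<in>UNIV. share r x i) = 1"
  using mass_pos[of x r]
  by (simp add: share_def sum.If_cases flip: sum_divide_distrib)
    (simp add: vertex_mass_def edge_weight_def)

lemma curvature_share: "curvature e r $ i = 2 * (\<Sum>x\<in>V. share r x i) - 2"
proof -
  have "(\<Sum>x\<in>V. share r x i) = (\<Sum>x\<in>e i. share r x i)"
    by (intro sum.mono_neutral_right) (simp_all add: edge share_def)
  then show ?thesis
    by (simp add: curvature_def edge_weight_def share_def sum_distrib_left)
qed

text \<open>Double counting: each vertex distributes total share 1 over its edges. Hence \<kappa>bar
  is the only possible constant curvature, and the deviation from it is tangent to the hyperplanes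
  of constant coordinate sum.\<close>

lemma sum_curvature: "(\<Sum>i\<in>UNIV. curvature e r $ i) = CARD('n) * mean_curvature V E"
proof -
  have "(\<Sum>i\<in>UNIV. curvature e r $ i) = 2 * (\<Sum>x\<in>V. \<Sum>i\<in>UNIV. share r x i) - 2 * CARD('n)"
    by (subst sum.swap) (simp add: curvature_share sum_subtractf sum_distrib_left)
  also have "\<dots> = CARD('n) * mean_curvature V E"
    by (simp add: sum_share mean_curvature_def card_E field_simps)
  finally show ?thesis .
qed

lemma exp_component_has_derivative:
  "((\<lambda>r. exp (r $ i)) has_derivative (\<lambda>h. exp (r $ i) * h $ i)) (at (r :: real ^ 'n))"
  using DERIV_compose_FDERIV[OF DERIV_exp
      bounded_linear_imp_has_derivative[OF bounded_linear_vec_nth[of i], of "at r"]]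
  by (simp add: mult.commute)

lemma vertex_mass_has_derivative:
  "((\<lambda>r. vertex_mass e r x) has_derivative (\<lambda>h. \<Sum>j\<in>{j. x \<in> e j}. exp (r $ j) * h $ j)) (at r)"
  unfolding vertex_mass_def edge_weight_def
  by (intro has_derivative_sum exp_component_has_derivative)

lemma sum_share_mult: "x \<in> V \<Longrightarrow>
   (\<Sum>j\<in>UNIV. share r x j * h j) = (\<Sum>j\<in>{j. x \<in> e j}. exp (r $ j) * h j) / vertex_mass e r x"
  by (simp add: share_def sum_divide_distrib if_distrib[of "\<lambda>x. x * _"] sum.If_cases cong: if_cong)

lemma share_has_derivative:
  assumes x: "x \<in> V"
  shows "((\<lambda>r. share r x i) has_derivative
    (\<lambda>h. share r x i * (h $ i - (\<Sum>j\<in>UNIV. share r x j * h $ j)))) (at r)"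
proof (cases "x \<in> e i")
  case True
  show ?thesis
    using has_derivative_divide'[OF exp_component_has_derivative[of i r] vertex_mass_has_derivative[of x r]] mass_pos[OF x, of r]
    unfolding share_def[of _ x i] if_P[OF True] sum_share_mult[OF x]
    by (simp add: field_simps)
qed (simp add: share_def)

text \<open>The weights of the graph Laplacian J on the line graph. The entries with i = j are
  harmless, since they only ever multiply a vanishing difference.\<close>

definition coupling :: "real ^ 'n \<Rightarrow> 'n \<Rightarrow> 'n \<Rightarrow> real" where
  "coupling r i j = 2 * (\<Sum>x\<in>V. share r x i * share r x j)"

lemma coupling_commute: "coupling r i j = coupling r j i"
  by (simp add: coupling_def mult.commute)

lemma coupling_nonneg: "coupling r i j \<ge> 0"
  by (simp add: coupling_def sum_nonneg share_nonneg)

lemma coupling_pos: "x \<in> e i \<Longrightarrow> x \<in> e j \<Longrightarrow> coupling r i j > 0"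
  unfolding coupling_def using edge(1)[of i]
  by (intro mult_pos_pos sum_pos2[of _ x]) (auto simp: share_pos share_nonneg)

lemma coupling_disjoint: "e i \<inter> e j = {} \<Longrightarrow> coupling r i j = 0"
  by (auto simp: coupling_def share_def intro!: sum.neutral)

lemma curvature_has_derivative:
  "(curvature e has_derivative (\<lambda>h. \<chi> i. \<Sum>j\<in>UNIV. coupling r i j * (h $ i - h $ j))) (at r)"
  (is "(_ has_derivative ?D) _")
proof -
  have "((\<lambda>r. curvature e r $ i) has_derivative (\<lambda>h. ?D h $ i)) (at r)" for i
  proof -
    have "((\<lambda>r. curvature e r $ i) has_derivative
       (\<lambda>h. 2 * (\<Sum>x\<in>V. share r x i * (h $ i - (\<Sum>j\<in>UNIV. share r x j * h $ j))))) (at r)"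
      unfolding curvature_share
      by (auto intro!: derivative_eq_intros share_has_derivative)
    moreover have "2 * (\<Sum>x\<in>V. share r x i * (h $ i - (\<Sum>j\<in>UNIV. share r x j * h $ j))) = ?D h $ i" for h
    proof -
      have "(\<Sum>j\<in>UNIV. coupling r i j * (h $ i - h $ j)) =
          2 * (\<Sum>x\<in>V. share r x i * (\<Sum>j\<in>UNIV. share r x j * (h $ i - h $ j)))"
        unfolding coupling_def sum_distrib_left sum_distrib_right
        by (subst sum.swap) (simp add: mult_ac)
      \<comment> \<open>The shares at x sum to 1, so an average of the differences from h_i is h_i
        minus the average.\<close>
      also have "(\<Sum>x\<in>V. share r x i * (\<Sum>j\<in>UNIV. share r x j * (h $ i - h $ j))) =
          (\<Sum>x\<in>V. share r x i * (h $ i - (\<Sum>j\<in>UNIV. share r x j * h $ j)))"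
        by (intro sum.cong refl)
          (simp add: right_diff_distrib sum_subtractf sum_distrib_right[symmetric] sum_share)
      finally show ?thesis by simp
    qed
    ultimately show ?thesis by simp
  qed
  then show ?thesis
    by (subst has_derivative_componentwise_within) (auto simp: Basis_vec_def inner_axis)
qed

lemma curvature_jacobian_mult_vec:
  "(curvature_jacobian e r *v h) $ i = (\<Sum>j\<in>UNIV. coupling r i j * (h $ i - h $ j))"
proof -
  let ?D = "\<lambda>h. \<chi> i. \<Sum>j\<in>UNIV. coupling r i j * (h $ i - h $ j)"
  have "curvature_jacobian e r = matrix ?D"
    unfolding curvature_jacobian_def jacobian_def
    by (subst frechet_derivative_at[OF curvature_has_derivative, symmetric]) (rule refl)
  moreover have "bounded_linear ?D" using curvature_has_derivative has_derivative_bounded_linear by blast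
  ultimately have "curvature_jacobian e r *v h = ?D h"
    using fun_cong[OF matrix_vector_mul(3)[of ?D], of h] by simp
  then show ?thesis by simp
qed

lemma curvature_jacobian_offdiag:
  assumes "i \<noteq> j"
  shows "curvature_jacobian e r $ i $ j = - coupling r i j"
proof -
  have "curvature_jacobian e r $ i $ j = (curvature_jacobian e r *v axis j 1) $ i"
    by (simp add: matrix_vector_mult_basis column_def)
  also have "\<dots> = (\<Sum>k\<in>UNIV. if k = j then - coupling r i j else 0)"
    unfolding curvature_jacobian_mult_vec using assms
    by (intro sum.cong) (auto simp: axis_def)
  finally show ?thesis by simp
qed

lemma transpose_curvature_jacobian: "transpose (curvature_jacobian e r) = curvature_jacobian e r"
proof -
  have "curvature_jacobian e r $ j $ i = curvature_jacobian e r $ i $ j" for i j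
    using curvature_jacobian_offdiag coupling_commute by (cases "i = j") auto
  then show ?thesis by (simp add: transpose_def vec_eq_iff)
qed

text \<open>One nonlinear graph Laplacian for two of the flows: the identity gives the Laplacian,
  |a|^(p-2) a the p-Laplacian. Conservation follows from oddness of \<psi>, descent from oddness
  together with its sign.\<close>

definition flux :: "(real \<Rightarrow> real) \<Rightarrow> real ^ 'n \<Rightarrow> real ^ 'n \<Rightarrow> real ^ 'n" where
  "flux \<psi> r g = (\<chi> i. \<Sum>j\<in>UNIV. coupling r i j * \<psi> (g $ j - g $ i))"

text \<open>Summation by parts: the coupling is symmetric and \<psi> is odd, so averaging over the
  exchange of i and j produces an energy. Its sign is visible for g = h, and it vanishes for
  constant g.\<close>

lemma inner_flux:
  assumes odd: "\<And>a. \<psi> (- a) = - \<psi> a"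
  shows "g \<bullet> flux \<psi> r h = - (\<Sum>i\<in>UNIV. \<Sum>j\<in>UNIV. coupling r i j * ((g $ j - g $ i) * \<psi> (h $ j - h $ i))) / 2"
proof -
  let ?a = "\<lambda>i j. g $ i * (coupling r i j * \<psi> (h $ j - h $ i))"
  have 1: "g \<bullet> flux \<psi> r h = (\<Sum>i\<in>UNIV. \<Sum>j\<in>UNIV. ?a i j)"
    by (simp add: flux_def inner_vec_def sum_distrib_left)
  then have 2: "g \<bullet> flux \<psi> r h = (\<Sum>i\<in>UNIV. \<Sum>j\<in>UNIV. ?a j i)"
    by (subst sum.swap) simp
  have "coupling r i j * ((g $ j - g $ i) * \<psi> (h $ j - h $ i)) = - ?a i j - ?a j i" for i j
    using odd[of "h $ j - h $ i"] coupling_commute[of r i j] by (simp add: algebra_simps)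
  then show ?thesis using 1 2 by (simp add: sum_subtractf sum_negf)
qed

lemma sum_flux: "(\<And>a. \<psi> (- a) = - \<psi> a) \<Longrightarrow> 1 \<bullet> flux \<psi> r g = 0"
  by (simp add: inner_flux)

lemma inner_flux_nonpos:
  assumes odd: "\<And>a. \<psi> (- a) = - \<psi> a" and pos: "\<And>a. a \<noteq> 0 \<Longrightarrow> a * \<psi> a > 0"
  shows "g \<bullet> flux \<psi> r g \<le> 0"
proof -
  have "a * \<psi> a \<ge> 0" for a using pos[of a] by (cases "a = 0") auto
  then show ?thesis
    unfolding inner_flux[of \<psi>, OF odd] by (simp add: sum_nonneg coupling_nonneg)
qed

lemma inner_flux_neg:
  assumes odd: "\<And>a. \<psi> (- a) = - \<psi> a" and pos: "\<And>a. a \<noteq> 0 \<Longrightarrow> a * \<psi> a > 0"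
    and "g $ i \<noteq> g $ j"
  shows "g \<bullet> flux \<psi> r g < 0"
proof -
  have nonneg: "a * \<psi> a \<ge> 0" for a using pos[of a] by (cases "a = 0") auto
  \<comment> \<open>Different values anywhere force different values on two edges sharing a vertex,
    where the coupling is positive.\<close>
  obtain i j x where ij: "x \<in> e i" "x \<in> e j" "g $ i \<noteq> g $ j"
    using constant_if_locally_constant[of "($) g"] assms(3) by metis
  let ?a = "\<lambda>i j. coupling r i j * ((g $ j - g $ i) * \<psi> (g $ j - g $ i))"
  have a: "?a i j \<ge> 0" for i j using coupling_nonneg nonneg by simp
  have "?a i j > 0" using coupling_pos[OF ij(1,2)] pos[of "g $ j - g $ i"] ij(3) by simp
  then have "(\<Sum>j\<in>UNIV. ?a i j) > 0" by (rule sum_pos2[OF finite UNIV_I _ a])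
  then have "(\<Sum>i\<in>UNIV. \<Sum>j\<in>UNIV. ?a i j) > 0"
    by (rule sum_pos2[OF finite UNIV_I]) (intro sum_nonneg a)
  then show ?thesis unfolding inner_flux[of \<psi>, OF odd] by simp
qed

lemma curvature_jacobian_flux: "curvature_jacobian e r *v g = - flux (\<lambda>a. a) r g"
  by (simp add: vec_eq_iff curvature_jacobian_mult_vec flux_def sum_negf[symmetric] algebra_simps)

lemma curvature_jacobian_kernel:
  assumes "curvature_jacobian e r *v g = 0"
  shows "g $ i = g $ j"
proof (rule ccontr)
  assume "g $ i \<noteq> g $ j"
  then have "g \<bullet> flux (\<lambda>a. a) r g < 0"
    by (intro inner_flux_neg) (auto simp flip: power2_eq_square)
  then show False using assms by (simp add: curvature_jacobian_flux)
qed

lemma curvature_jacobian_inner_nonneg: "g \<bullet> (curvature_jacobian e r *v g) \<ge> 0"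
  unfolding curvature_jacobian_flux
  using inner_flux_nonpos[of "\<lambda>a. a" g r] by (simp flip: power2_eq_square)

section \<open>Continuity of shares, curvature and Jacobian\<close>

lemma continuous_share: "x \<in> V \<Longrightarrow> continuous_on UNIV (\<lambda>r. share r x i)"
  by (rule has_derivative_continuous_on) (rule has_derivative_at_withinI[OF share_has_derivative])

lemma continuous_coupling: "continuous_on UNIV (\<lambda>r. coupling r i j)"
  unfolding coupling_def by (intro continuous_intros continuous_share)

lemma continuous_curvature: "continuous_on UNIV (curvature e)"
  by (rule has_derivative_continuous_on) (rule has_derivative_at_withinI[OF curvature_has_derivative])

lemma continuous_flux:
  assumes "continuous_on UNIV \<psi>"
  shows "continuous_on UNIV (\<lambda>r. flux \<psi> r (curvature e r))"
  unfolding flux_def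
  by (intro continuous_on_vec_lambda continuous_intros continuous_coupling
      continuous_on_compose2[OF assms] continuous_curvature) auto

lemma continuous_curvature_jacobian: "continuous_on UNIV (curvature_jacobian e)"
proof -
  have eq: "curvature_jacobian e r =
      (\<chi> i j. \<Sum>k\<in>UNIV. coupling r i k * (axis j 1 $ i - axis j 1 $ k))" for r
    unfolding curvature_jacobian_mult_vec[symmetric]
    by (simp add: vec_eq_iff matrix_vector_mult_basis column_def)
  show ?thesis
    unfolding eq by (intro continuous_on_vec_lambda continuous_intros continuous_coupling)
qed

end

section \<open>The convex potential of the curvature\<close>

lemma exp_gt_one_plus: "(x :: real) \<noteq> 0 \<Longrightarrow> 1 + x < exp x"
proof -
  assume x: "x \<noteq> 0"
  show ?thesis
  proof (cases "1 + x / 2 \<ge> 0")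
    case True
    have "1 + x < (1 + x / 2)\<^sup>2" using x by (simp add: power2_sum power_divide)
    also have "\<dots> \<le> (exp (x / 2))\<^sup>2" using True by (intro power_mono exp_ge_add_one_self) auto
    also have "\<dots> = exp x" by (simp add: power2_eq_square flip: exp_add)
    finally show ?thesis .
  next
    case False
    then have "1 + x < 0" by simp
    then show ?thesis using exp_gt_zero[of x] by linarith
  qed
qed

text \<open>Centred at the mean m, the tangent bound 1 + y \<le> exp y has average 1 on its left
  side, and it is strict at every point off the mean, which counts as soon as that point has
  positive weight.\<close>

lemma ln_sum_exp_ge:
  fixes p h :: "'a \<Rightarrow> real"
  assumes "finite S" and p: "\<And>i. i \<in> S \<Longrightarrow> p i \<ge> 0" "(\<Sum>i\<in>S. p i) = 1"
  shows "(\<Sum>i\<in>S. p i * h i) \<le> ln (\<Sum>i\<in>S. p i * exp (h i))"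
    and "j \<in> S \<Longrightarrow> p j > 0 \<Longrightarrow> h j \<noteq> (\<Sum>i\<in>S. p i * h i) \<Longrightarrow>
      (\<Sum>i\<in>S. p i * h i) < ln (\<Sum>i\<in>S. p i * exp (h i))"
proof -
  define m where "m = (\<Sum>i\<in>S. p i * h i)"
  have split: "(\<Sum>i\<in>S. p i * exp (h i)) = exp m * (\<Sum>i\<in>S. p i * exp (h i - m))"
    by (simp add: sum_distrib_left mult.left_commute[of "exp m"] flip: exp_add)
  have 1: "(\<Sum>i\<in>S. p i * (1 + (h i - m))) = 1"
    using p(2) by (simp add: distrib_left right_diff_distrib sum.distrib sum_subtractf
        flip: m_def sum_distrib_right)
  have le: "p i * (1 + (h i - m)) \<le> p i * exp (h i - m)" if "i \<in> S" for i
    using p(1)[OF that] by (intro mult_left_mono exp_ge_add_one_self)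
  have "(\<Sum>i\<in>S. p i * (1 + (h i - m))) \<le> (\<Sum>i\<in>S. p i * exp (h i - m))"
    by (rule sum_mono[OF le])
  then have ge: "1 \<le> (\<Sum>i\<in>S. p i * exp (h i - m))" unfolding 1 .
  have ln: "ln (\<Sum>i\<in>S. p i * exp (h i)) = m + ln (\<Sum>i\<in>S. p i * exp (h i - m))"
    using ge unfolding split by (subst ln_mult) auto
  show "(\<Sum>i\<in>S. p i * h i) \<le> ln (\<Sum>i\<in>S. p i * exp (h i))"
    using ge unfolding ln m_def[symmetric] by simp
  assume j: "j \<in> S" "p j > 0" "h j \<noteq> (\<Sum>i\<in>S. p i * h i)"
  have "p j * (1 + (h j - m)) < p j * exp (h j - m)"
    using j exp_gt_one_plus[of "h j - m"] by (simp add: m_def)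
  then have "(\<Sum>i\<in>S. p i * (1 + (h i - m))) < (\<Sum>i\<in>S. p i * exp (h i - m))"
    using j(1) le by (intro sum_strict_mono_ex1 \<open>finite S\<close>) blast+
  then show "(\<Sum>i\<in>S. p i * h i) < ln (\<Sum>i\<in>S. p i * exp (h i))"
    unfolding 1 ln m_def[symmetric] by simp
qed

text \<open>One layer-cake term, with A as common lower bound for all the levels.\<close>

lemma has_integral_step:
  assumes "A \<le> a" "a \<le> B"
  shows "((\<lambda>t. if t < a then 1 else 0 :: real) has_integral (a - A)) {A..B}"
proof -
  have "((\<lambda>t. 1 :: real) has_integral (a - A)) {A..a}"
    using has_integral_const_real[of "1 :: real" A a] assms by simp
  then have "((\<lambda>t. if t \<in> {A..a} then 1 else 0 :: real) has_integral (a - A)) {A..B}"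
    using assms by (subst has_integral_restrict) auto
  then show ?thesis
    by (rule has_integral_spike_finite[of "{a}", rotated 2]) auto
qed

context enumerated_graph
begin

text \<open>Adding a constant c to all coordinates changes nothing: the mass terms gain 2 |V| c and
  the linear term takes the same away. Compactness and uniqueness of minimisers can therefore hold
  only with the coordinate sum fixed.\<close>

definition potential :: "real ^ 'n \<Rightarrow> real" where
  "potential r = 2 * (\<Sum>x\<in>V. ln (vertex_mass e r x)) - (2 + mean_curvature V E) * (\<Sum>i\<in>UNIV. r $ i)"

lemma mean_curvature_eq: "2 + mean_curvature V E = 2 * (real (card V) / real CARD('n))"
  by (simp add: mean_curvature_def card_E)

lemma potential_has_derivative:
  "(potential has_derivative (\<lambda>h. (curvature e r - vec (mean_curvature V E)) \<bullet> h)) (at r)"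
proof -
  have ln: "((\<lambda>r. ln (vertex_mass e r x)) has_derivative (\<lambda>h. \<Sum>j\<in>UNIV. share r x j * h $ j)) (at r)"
    if x: "x \<in> V" for x
    using DERIV_compose_FDERIV[OF DERIV_ln[OF mass_pos[OF x, of r]] vertex_mass_has_derivative]
    unfolding sum_share_mult[OF x] by (simp add: field_simps)
  have "(potential has_derivative (\<lambda>h. 2 * (\<Sum>x\<in>V. \<Sum>j\<in>UNIV. share r x j * h $ j)
      - (2 + mean_curvature V E) * (\<Sum>i\<in>UNIV. h $ i))) (at r)"
    unfolding potential_def
    by (intro has_derivative_diff has_derivative_mult_right has_derivative_sum ln
        bounded_linear_imp_has_derivative bounded_linear_vec_nth)
  moreover have "2 * (\<Sum>x\<in>V. \<Sum>j\<in>UNIV. share r x j * h $ j) - (2 + mean_curvature V E) * (\<Sum>i\<in>UNIV. h $ i)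
      = (curvature e r - vec (mean_curvature V E)) \<bullet> h" for h
  proof -
    have "(\<Sum>x\<in>V. \<Sum>j\<in>UNIV. share r x j * h $ j) = (\<Sum>j\<in>UNIV. (\<Sum>x\<in>V. share r x j) * h $ j)"
      by (subst sum.swap) (simp add: sum_distrib_right)
    moreover have "(curvature e r - vec (mean_curvature V E)) \<bullet> h =
        (\<Sum>j\<in>UNIV. 2 * ((\<Sum>x\<in>V. share r x j) * h $ j) - (2 + mean_curvature V E) * h $ j)"
      unfolding inner_vec_def by (intro sum.cong refl) (simp add: curvature_share algebra_simps)
    ultimately show ?thesis
      by (simp add: sum_subtractf flip: sum_distrib_left)
  qed
  ultimately show ?thesis by simp
qed

lemma continuous_potential: "continuous_on S potential"
  by (rule has_derivative_continuous_on) (rule has_derivative_at_withinI[OF potential_has_derivative])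

lemma inner_one: "1 \<bullet> (r :: real ^ 'n) = (\<Sum>i\<in>UNIV. r $ i)"
  by (simp add: inner_vec_def)

lemma sum_curvature_deviation:
  "(\<Sum>i\<in>UNIV. (curvature e r - vec (mean_curvature V E)) $ i) = 0"
  by (simp add: sum_subtractf sum_curvature)

text \<open>Strictness in Jensen's inequality forces \<open>r' - r\<close> to be constant on the edges at each
  vertex, hence constant by connectedness.\<close>

lemma potential_strict_min:
  assumes crit: "\<And>i. curvature e r $ i = mean_curvature V E"
    and sum: "(\<Sum>i\<in>UNIV. r' $ i) = (\<Sum>i\<in>UNIV. r $ i)" and neq: "r' \<noteq> r"
  shows "potential r < potential r'"
proof -
  define h where "h = r' - r"
  \<comment> \<open>The ratio of the two masses at x is the mean of exp h under the shares at r, so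
    Jensen bounds its logarithm below by the mean of h.\<close>
  have mass: "ln (vertex_mass e r' x) = ln (vertex_mass e r x) + ln (\<Sum>j\<in>UNIV. share r x j * exp (h $ j))"
    if x: "x \<in> V" for x
  proof -
    have "vertex_mass e r' x = (\<Sum>j\<in>{j. x \<in> e j}. exp (r $ j) * exp (h $ j))"
      by (simp add: vertex_mass_def edge_weight_def h_def flip: exp_add)
    then have eq: "vertex_mass e r' x = vertex_mass e r x * (\<Sum>j\<in>UNIV. share r x j * exp (h $ j))"
      using mass_pos[OF x, of r] by (simp add: sum_share_mult[OF x])
    then have "(\<Sum>j\<in>UNIV. share r x j * exp (h $ j)) > 0"
      using mass_pos[OF x, of r] mass_pos[OF x, of r'] by (metis zero_less_mult_pos)
    then show ?thesis unfolding eq using mass_pos[OF x, of r] by (simp add: ln_mult)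
  qed
  have "\<exists>i j. h $ i \<noteq> h $ j"
  proof (rule ccontr)
    assume "\<not> ?thesis"
    then have const: "h $ i = h $ undefined" for i by blast
    have "(\<Sum>i\<in>UNIV. h $ i) = 0" using sum by (simp add: h_def sum_subtractf)
    moreover have "(\<Sum>i\<in>UNIV. h $ i) = (\<Sum>i\<in>(UNIV :: 'n set). h $ undefined)"
      by (rule sum.cong[OF refl const])
    ultimately have "h $ undefined = 0" by simp
    then have "h $ i = 0" for i using const[of i] by simp
    then show False using neq by (simp add: h_def vec_eq_iff)
  qed
  then obtain i j x where ij: "x \<in> e i" "x \<in> e j" "h $ i \<noteq> h $ j"
    using constant_if_locally_constant[of "($) h"] by metis
  have x: "x \<in> V" using ij edge by blast
  let ?m = "\<lambda>x. \<Sum>j\<in>UNIV. share r x j * h $ j"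
  let ?l = "\<lambda>x. ln (\<Sum>j\<in>UNIV. share r x j * exp (h $ j))"
  obtain k where k: "x \<in> e k" "h $ k \<noteq> ?m x" using ij by metis
  have le: "?m y \<le> ?l y" if "y \<in> V" for y
    by (rule ln_sum_exp_ge) (simp_all add: share_nonneg sum_share that)
  have less: "?m x < ?l x"
    by (rule ln_sum_exp_ge(2)[of _ _ k]) (simp_all add: share_nonneg sum_share x share_pos k)
  have "(\<Sum>y\<in>V. ?m y) < (\<Sum>y\<in>V. ?l y)"
    using le less x by (intro sum_strict_mono_ex1) auto
  \<comment> \<open>At constant curvature all edges have the same total share, so these means add up
    to a multiple of the sum of h, which is 0.\<close>
  moreover have "(\<Sum>y\<in>V. ?m y) = 0"
  proof -
    have "(\<Sum>y\<in>V. ?m y) = (\<Sum>j\<in>UNIV. (\<Sum>y\<in>V. share r y j) * h $ j)"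
      by (subst sum.swap) (simp add: sum_distrib_right)
    also have "\<dots> = (\<Sum>j\<in>UNIV. (1 + mean_curvature V E / 2) * h $ j)"
    proof (rule sum.cong[OF refl])
      fix j
      have "(\<Sum>y\<in>V. share r y j) = 1 + mean_curvature V E / 2"
        using crit[of j] by (simp add: curvature_share)
      then show "(\<Sum>y\<in>V. share r y j) * h $ j = (1 + mean_curvature V E / 2) * h $ j" by simp
    qed
    also have "\<dots> = 0" using sum by (simp add: h_def sum_subtractf flip: sum_distrib_left)
    finally show ?thesis .
  qed
  ultimately show ?thesis
    unfolding potential_def sum by (simp add: mass sum.distrib)
qed

section \<open>Coercivity and the density condition\<close>

definition sparse :: bool where
  "sparse \<longleftrightarrow> (\<forall>\<Omega>. \<Omega> \<noteq> {} \<longrightarrow> \<Omega> \<subset> V \<longrightarrow>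
     card (induced_edges E \<Omega>) * card V < CARD('n) * card \<Omega>)"

lemma card_induced_edges: "card (induced_edges E \<Omega>) = card {i. e i \<subseteq> \<Omega>}"
proof -
  have "induced_edges E \<Omega> = e ` {i. e i \<subseteq> \<Omega>}"
    using enum by (auto simp: induced_edges_def bij_betw_def)
  then show ?thesis
    using enum by (simp add: card_image bij_betw_def inj_on_subset[OF _ subset_UNIV])
qed

lemma sparse_iff:
  "sparse \<longleftrightarrow> Max {real (card (induced_edges E \<Omega>)) / real (card \<Omega>) | \<Omega>. \<Omega> \<noteq> {} \<and> \<Omega> \<subset> V}
    < real (card E) / real (card V)" (is "_ \<longleftrightarrow> Max ?M < _")
proof -
  have M: "?M = (\<lambda>\<Omega>. real (card (induced_edges E \<Omega>)) / real (card \<Omega>)) ` {\<Omega>. \<Omega> \<noteq> {} \<and> \<Omega> \<subset> V}"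
    by blast
  have fin: "finite ?M"
    unfolding M by (rule finite_imageI, rule finite_subset[of _ "Pow V"]) auto
  \<comment> \<open>\<open>Max\<close> is informative only on a nonempty set: one endpoint of an
    edge is a nonempty proper subset of V.\<close>
  have ne: "?M \<noteq> {}"
  proof -
    obtain x where x: "x \<in> e undefined" using edge(2)[of undefined] by fastforce
    have "{x} \<noteq> e undefined" using edge(2)[of undefined] by (metis One_nat_def Suc_1 card.empty card.insert card_1_singleton_iff n_not_Suc_n)
    then have "{x} \<subset> V" using x edge(1)[of undefined] by blast
    then show ?thesis unfolding M by blast
  qed
  have iff: "real (card (induced_edges E \<Omega>)) / real (card \<Omega>) < real (card E) / real (card V) \<longleftrightarrow>
      card (induced_edges E \<Omega>) * card V < CARD('n) * card \<Omega>" if "\<Omega> \<noteq> {}" "\<Omega> \<subset> V" for \<Omega>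
  proof -
    have "card \<Omega> > 0" using that finite_subset[of \<Omega> V] by (auto simp: card_gt_0_iff)
    then show ?thesis using card_V_pos
      by (simp add: card_E divide_less_eq less_divide_eq mult.commute flip: of_nat_mult)
  qed
  have "Max ?M < real (card E) / real (card V) \<longleftrightarrow> (\<forall>a\<in>?M. a < real (card E) / real (card V))"
    by (rule Max_less_iff[OF fin ne])
  also have "\<dots> \<longleftrightarrow> (\<forall>\<Omega>. \<Omega> \<noteq> {} \<longrightarrow> \<Omega> \<subset> V \<longrightarrow>
      real (card (induced_edges E \<Omega>)) / real (card \<Omega>) < real (card E) / real (card V))"
    by blast
  also have "\<dots> \<longleftrightarrow> sparse"
    unfolding sparse_def by (intro all_cong1 imp_cong refl iff)
  finally show ?thesis by (rule sym)
qed

section \<open>Necessity of the density condition\<close>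

lemma constant_curvature_imp_sparse:
  assumes crit: "\<And>i. curvature e r $ i = mean_curvature V E"
  shows sparse
  unfolding sparse_def
proof (intro allI impI)
  fix \<Omega> assume \<Omega>: "\<Omega> \<noteq> {}" "\<Omega> \<subset> V"
  have fin: "finite \<Omega>" using \<Omega> finite_subset[of \<Omega> V] by auto
  let ?I = "{i. e i \<subseteq> \<Omega>}"
  have share_sum: "(\<Sum>x\<in>V. share r x i) = card V / CARD('n)" for i
    using crit[of i] mean_curvature_eq by (simp add: curvature_share)
  have "\<exists>i x. x \<in> e i \<and> x \<in> \<Omega> \<and> \<not> e i \<subseteq> \<Omega>"
  proof (rule ccontr)
    assume no: "\<not> ?thesis"
    obtain x y where xy: "x \<in> \<Omega>" "y \<in> V" "y \<notin> \<Omega>" using \<Omega> by blast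
    then have "x \<in> V" using \<Omega> by blast
    from this \<open>y \<in> V\<close> have "y \<in> \<Omega>"
      by (induction rule: reachable_induct) (use xy no in blast)+
    then show False using xy by simp
  qed
  then obtain i x where ix: "x \<in> e i" "x \<in> \<Omega>" "\<not> e i \<subseteq> \<Omega>" by blast
  have "card ?I * (card V / CARD('n)) = (\<Sum>i\<in>?I. \<Sum>x\<in>V. share r x i)"
    by (simp add: share_sum)
  \<comment> \<open>An edge inside \<Omega> has share 0 at vertices outside, so \<Omega> collects
    its whole share. After the swap each vertex contributes at most 1, and less where an edge leaves
    \<Omega>.\<close>
  also have "\<dots> = (\<Sum>i\<in>?I. \<Sum>x\<in>\<Omega>. share r x i)"
    using \<Omega> by (intro sum.cong refl sum.mono_neutral_right) (auto simp: share_def)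
  also have "\<dots> = (\<Sum>x\<in>\<Omega>. \<Sum>i\<in>?I. share r x i)" by (rule sum.swap)
  also have "\<dots> < (\<Sum>x\<in>\<Omega>. 1)"
  proof (rule sum_strict_mono_ex1[OF fin])
    have split: "(\<Sum>i\<in>?I. share r y i) + (\<Sum>i\<in>-?I. share r y i) = 1" if "y \<in> \<Omega>" for y
      using sum_share[of y r] that \<Omega> sum.subset_diff[of ?I UNIV "share r y"]
      by (auto simp: Compl_eq_Diff_UNIV add.commute)
    show "\<forall>y\<in>\<Omega>. (\<Sum>i\<in>?I. share r y i) \<le> 1"
      using split sum_nonneg[of "-?I" "share r _"] share_nonneg by (smt (verit))
    have "(\<Sum>i\<in>-?I. share r x i) > 0"
      using ix by (intro sum_pos2[of _ i]) (auto simp: share_nonneg share_pos)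
    then have "(\<Sum>i\<in>?I. share r x i) < 1" using split[OF ix(2)] by linarith
    then show "\<exists>y\<in>\<Omega>. (\<Sum>i\<in>?I. share r y i) < 1" using ix(2) by blast
  qed
  finally have "real (card ?I) * real (card V) < real CARD('n) * real (card \<Omega>)"
    by (simp add: field_simps)
  then show "card (induced_edges E \<Omega>) * card V < CARD('n) * card \<Omega>"
    unfolding card_induced_edges by (metis of_nat_less_iff of_nat_mult)
qed

text \<open>Passes from vertex sets to edge sets U. With W the vertices covered by U, all edges of U
  are induced by W, so the density condition applies to W; if W = V, strictness comes from U missing
  an edge. There are finitely many U, hence a uniform gap.\<close>

lemma sparse_gap:
  assumes sparse
  obtains \<delta> :: real where "\<delta> > 0"
    "\<And>U. U \<noteq> {} \<Longrightarrow> U \<noteq> UNIV \<Longrightarrow> \<delta> \<le> card (\<Union>(e ` U)) - card V / CARD('n) * card U"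
proof -
  let ?f = "\<lambda>U. real (card (\<Union>(e ` U))) - card V / CARD('n) * card U"
  have pos: "?f U > 0" if U: "U \<noteq> {}" "U \<noteq> UNIV" for U
  proof -
    define W where "W = \<Union>(e ` U)"
    have "W \<subseteq> V" using edge(1) by (auto simp: W_def)
    have "e k \<noteq> {}" for k using edge(2)[of k] by auto
    then have "W \<noteq> {}" using U by (auto simp: W_def)
    note W = \<open>W \<subseteq> V\<close> \<open>W \<noteq> {}\<close>
    have "card U * card V < CARD('n) * card W"
    proof (cases "W = V")
      case True
      have "card U < CARD('n)" using U by (intro psubset_card_mono) auto
      then show ?thesis using True card_V_pos by simp
    next
      case False
      have "card U \<le> card {i. e i \<subseteq> W}" by (intro card_mono) (auto simp: W_def)
      then have "card U * card V \<le> card (induced_edges E W) * card V"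
        by (simp add: card_induced_edges)
      also have "\<dots> < CARD('n) * card W" using assms W False by (auto simp: sparse_def)
      finally show ?thesis .
    qed
    then have "real (card U) * real (card V) < real CARD('n) * real (card W)"
      by (metis of_nat_less_iff of_nat_mult)
    then show ?thesis by (simp add: W_def field_simps)
  qed
  \<comment> \<open>The 1 keeps the minimum meaningful when there is a single edge and no U
    qualifies.\<close>
  define M where "M = insert 1 (?f ` {U. U \<noteq> {} \<and> U \<noteq> UNIV})"
  have "finite M" by (simp add: M_def)
  then have "Min M > 0" using pos by (subst Min_gr_iff) (auto simp: M_def)
  moreover have "Min M \<le> ?f U" if "U \<noteq> {}" "U \<noteq> UNIV" for U
    using that \<open>finite M\<close> by (intro Min_le) (auto simp: M_def)
  ultimately show thesis using that by blast
qed

text \<open>Writing \<open>max\<close> and \<open>r\<^sub>i\<close> as integrals of the indicators of their superlevel sets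
  reduces the bound to the combinatorial gap for each superlevel set of edges.\<close>

lemma potential_coercive:
  assumes sparse
  obtains \<delta> :: real where "\<delta> > 0" "\<And>r i j. \<delta> * (r $ i - r $ j) \<le> potential r"
proof -
  obtain \<delta> :: real where \<delta>: "\<delta> > 0"
    "\<And>U. U \<noteq> {} \<Longrightarrow> U \<noteq> UNIV \<Longrightarrow> \<delta> \<le> card (\<Union>(e ` U)) - card V / CARD('n) * card U"
    using sparse_gap[OF assms] by metis
  let ?c = "card V / CARD('n)"
  have "2 * \<delta> * (r $ i - r $ j) \<le> potential r" for r i j
  proof -
    define A B where "A = Min (range (($) r))" and "B = Max (range (($) r))"
    have AB: "A \<le> r $ k" "r $ k \<le> B" for k by (auto simp: A_def B_def)
    define mx where "mx x = Max (($) r ` {k. x \<in> e k})" for x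
    have mx: "\<And>k. x \<in> e k \<Longrightarrow> r $ k \<le> mx x" "\<exists>k. x \<in> e k \<and> mx x = r $ k" if "x \<in> V" for x
    proof -
      have "($) r ` {k. x \<in> e k} \<noteq> {}" using ex_incident[OF that] by blast
      then have "mx x \<in> ($) r ` {k. x \<in> e k}" unfolding mx_def by (intro Max_in) auto
      then show "\<exists>k. x \<in> e k \<and> mx x = r $ k" by auto
    qed (auto simp: mx_def)
    have mxAB: "A \<le> mx x" "mx x \<le> B" if "x \<in> V" for x using mx(2)[OF that] AB by auto
    let ?s = "\<lambda>a t. if t < a then 1 else 0 :: real"
    have I: "((\<lambda>t. (\<Sum>x\<in>V. ?s (mx x) t) - ?c * (\<Sum>k\<in>UNIV. ?s (r $ k) t)) has_integral
        ((\<Sum>x\<in>V. mx x - A) - ?c * (\<Sum>k\<in>UNIV. r $ k - A))) {A..B}"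
      by (intro has_integral_diff has_integral_sum has_integral_mult_right has_integral_step)
        (auto simp: AB mxAB)
    have A_le_B: "A \<le> B" using AB order_trans by blast
    have J: "((\<lambda>t. \<delta> * ?s B t) has_integral (\<delta> * (B - A))) {A..B}"
      using A_le_B by (intro has_integral_mult_right has_integral_step) auto
    \<comment> \<open>For A \<le> t < B the superlevel set of edges contains a maximal edge and
      omits a minimal one, so the gap applies; the vertices it covers are exactly those with t <
      \<open>mx x\<close>.\<close>
    have "\<delta> * (B - A) \<le> (\<Sum>x\<in>V. mx x - A) - ?c * (\<Sum>k\<in>UNIV. r $ k - A)"
    proof (rule has_integral_le[OF J I])
      fix t assume t: "t \<in> {A..B}"
      define U where "U = {k. t < r $ k}"
      have "\<Union>(e ` U) = {x \<in> V. t < mx x}"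
      proof safe
        fix x k assume "x \<in> e k" "k \<in> U"
        then show "x \<in> V" "t < mx x" using mx(1)[of x k] edge(1)[of k] by (auto simp: U_def)
      next
        fix x assume "x \<in> V" "t < mx x"
        then show "x \<in> \<Union>(e ` U)" using mx(2)[of x] by (auto simp: U_def)
      qed
      then have sums: "(\<Sum>x\<in>V. ?s (mx x) t) - ?c * (\<Sum>k\<in>UNIV. ?s (r $ k) t) = card (\<Union>(e ` U)) - ?c * card U"
        by (simp add: sum.If_cases U_def Int_def)
      have "A \<in> range (($) r)" "B \<in> range (($) r)" unfolding A_def B_def
        by (intro Min_in Max_in; simp)+
      then obtain k l where kl: "A = r $ k" "B = r $ l" by auto
      show "\<delta> * ?s B t \<le> (\<Sum>x\<in>V. ?s (mx x) t) - ?c * (\<Sum>k\<in>UNIV. ?s (r $ k) t)"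
      proof (cases "t < B")
        case True
        then have "l \<in> U" "k \<notin> U" using kl t by (auto simp: U_def)
        then have "\<delta> \<le> card (\<Union>(e ` U)) - ?c * card U" by (intro \<delta>(2)) auto
        then show ?thesis unfolding sums using True by simp
      next
        case False
        then have "\<not> t < r $ k" for k using AB(2)[of k] by linarith
        then have "U = {}" by (simp add: U_def)
        then show ?thesis unfolding sums using False by simp
      qed
    qed
    \<comment> \<open>The A terms cancel: there are |V| copies from the vertices and (|V| / |E|) |E|
      from the edges.\<close>
    also have "\<dots> = (\<Sum>x\<in>V. mx x) - ?c * (\<Sum>k\<in>UNIV. r $ k)"
      by (simp add: sum_subtractf right_diff_distrib)
    also have "(\<Sum>x\<in>V. mx x) \<le> (\<Sum>x\<in>V. ln (vertex_mass e r x))"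
    proof (rule sum_mono)
      fix x assume x: "x \<in> V"
      obtain k where k: "x \<in> e k" "mx x = r $ k" using mx(2)[OF x] by blast
      have "exp (r $ k) \<le> vertex_mass e r x"
        unfolding vertex_mass_def edge_weight_def by (rule member_le_sum) (use k in auto)
      then show "mx x \<le> ln (vertex_mass e r x)"
        using mass_pos[OF x, of r] k by (simp add: ln_ge_iff)
    qed
    finally have "\<delta> * (B - A) \<le> (\<Sum>x\<in>V. ln (vertex_mass e r x)) - ?c * (\<Sum>k\<in>UNIV. r $ k)"
      by simp
    moreover have "potential r = 2 * ((\<Sum>x\<in>V. ln (vertex_mass e r x)) - ?c * (\<Sum>k\<in>UNIV. r $ k))"
      unfolding potential_def mean_curvature_eq by (simp add: right_diff_distrib)
    ultimately have "2 * \<delta> * (B - A) \<le> potential r" by simp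
    moreover have "2 * \<delta> * (r $ i - r $ j) \<le> 2 * \<delta> * (B - A)"
      using AB[of i] AB[of j] \<delta>(1) by (intro mult_left_mono) auto
    ultimately show ?thesis by linarith
  qed
  then show thesis using that[of "2 * \<delta>"] \<delta>(1) by simp
qed

text \<open>Coercivity bounds all coordinate differences; with the sum prescribed, averaging r_i -
  r_j over j bounds r_i itself.\<close>

lemma compact_potential_sublevel:
  assumes sparse
  shows "compact {r. 1 \<bullet> r = \<sigma> \<and> potential r \<le> a}"
  unfolding compact_eq_bounded_closed
proof
  obtain \<delta> :: real where \<delta>: "\<delta> > 0" "\<And>r i j. \<delta> * (r $ i - r $ j) \<le> potential r"
    using potential_coercive[OF assms] by metis
  have "\<bar>r $ i\<bar> \<le> \<bar>\<sigma>\<bar> + \<bar>a\<bar> / \<delta>" if r: "1 \<bullet> r = \<sigma>" "potential r \<le> a" for r i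
  proof -
    have diff: "r $ i - r $ j \<le> \<bar>a\<bar> / \<delta>" for i j
      using \<delta>(2)[of r i j] r(2) \<delta>(1) by (simp add: pos_le_divide_eq mult.commute)
    have n: "real CARD('n) \<ge> 1" by (simp add: Suc_leI)
    have "CARD('n) * r $ i - \<sigma> = (\<Sum>j\<in>UNIV. r $ i - r $ j)"
      using r(1) by (simp add: inner_one sum_subtractf)
    moreover have "\<bar>\<Sum>j\<in>UNIV. r $ i - r $ j\<bar> \<le> (\<Sum>j\<in>(UNIV::'n set). \<bar>a\<bar> / \<delta>)"
      by (rule order_trans[OF sum_abs sum_mono]) (use diff in \<open>simp add: abs_le_iff\<close>)
    ultimately have "\<bar>CARD('n) * r $ i\<bar> \<le> \<bar>\<sigma>\<bar> + CARD('n) * (\<bar>a\<bar> / \<delta>)" by simp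
    also have "\<dots> \<le> CARD('n) * (\<bar>\<sigma>\<bar> + \<bar>a\<bar> / \<delta>)"
      using n mult_right_mono[OF n, of "\<bar>\<sigma>\<bar>"] by (simp add: distrib_left)
    finally show ?thesis using n by (simp add: abs_mult)
  qed
  then show "bounded {r. 1 \<bullet> r = \<sigma> \<and> potential r \<le> a}"
    by (intro boundedI[where B = "\<Sum>i\<in>(UNIV :: 'n set). \<bar>\<sigma>\<bar> + \<bar>a\<bar> / \<delta>"]
        order_trans[OF norm_le_l1_cart sum_mono]) blast
  have "closed ({r. 1 \<bullet> r = \<sigma>} \<inter> potential -` {..a})"
    by (intro continuous_closed_preimage continuous_potential closed_hyperplane closed_atMost)
  then show "closed {r. 1 \<bullet> r = \<sigma> \<and> potential r \<le> a}"
    by (simp add: Int_def vimage_def)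
qed

text \<open>Minimise the potential on the hyperplane. Its gradient G there has coordinate sum 0, so
  it is itself a tangent direction; the derivative along G is G \<bullet> G, which must vanish, and
  no Lagrange multiplier is left over.\<close>

lemma sparse_imp_constant_curvature:
  fixes r0 :: "real ^ 'n"
  assumes sparse
  obtains l where "1 \<bullet> l = 1 \<bullet> r0" "\<And>i. curvature e l $ i = mean_curvature V E"
proof -
  define S where "S = {r. 1 \<bullet> r = 1 \<bullet> r0 \<and> potential r \<le> potential r0}"
  have "compact S" unfolding S_def by (rule compact_potential_sublevel[OF assms])
  moreover have "r0 \<in> S" by (simp add: S_def)
  ultimately obtain l where l: "l \<in> S" "\<And>r. r \<in> S \<Longrightarrow> potential l \<le> potential r"
    using continuous_attains_inf[of S potential] continuous_potential by blast
  have min: "potential l \<le> potential r" if "1 \<bullet> r = 1 \<bullet> r0" for r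
    using l(1) l(2)[of r] l(2)[of r0] \<open>r0 \<in> S\<close> that by (cases "r \<in> S") (auto simp: S_def)
  define G where "G = curvature e l - vec (mean_curvature V E)"
  have G: "1 \<bullet> G = 0" unfolding inner_one G_def by (rule sum_curvature_deviation)
  have "((\<lambda>t. l + t *\<^sub>R G) has_derivative (\<lambda>t. t *\<^sub>R G)) (at 0)"
    by (auto intro!: derivative_eq_intros)
  moreover have "(potential has_derivative (\<lambda>h. G \<bullet> h)) (at (l + 0 *\<^sub>R G))"
    using potential_has_derivative[of l] by (simp add: G_def)
  ultimately have "((\<lambda>t. potential (l + t *\<^sub>R G)) has_derivative (\<lambda>t. G \<bullet> (t *\<^sub>R G))) (at 0)"
    by (rule has_derivative_compose)
  then have "DERIV (\<lambda>t. potential (l + t *\<^sub>R G)) 0 :> G \<bullet> G"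
    by (simp add: has_field_derivative_def mult.commute[of _ "G \<bullet> G"])
  moreover have "potential (l + 0 *\<^sub>R G) \<le> potential (l + t *\<^sub>R G)" for t
    using min[of "l + t *\<^sub>R G"] l(1) G by (simp add: inner_add_right S_def)
  ultimately have "G \<bullet> G = 0"
    using DERIV_local_min[of "\<lambda>t. potential (l + t *\<^sub>R G)" "G \<bullet> G" 0 1] by simp
  then have "curvature e l $ i = mean_curvature V E" for i
    by (simp add: G_def vec_eq_iff)
  moreover have "1 \<bullet> l = 1 \<bullet> r0" using l(1) by (simp add: S_def)
  ultimately show thesis using that by blast
qed

section \<open>Gradient-like flows\<close>

text \<open>The hypotheses speak of \<kappa> instead of the gradient \<kappa> - \<kappa>bar because
  conservation makes constant vectors orthogonal to \<open>F r\<close>.\<close>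

theorem flow_converges_iff:
  fixes F :: "real ^ 'n \<Rightarrow> real ^ 'n"
  assumes F: "continuous_on UNIV F" and conserved: "\<And>r. 1 \<bullet> F r = 0"
    and descent: "\<And>r i j. curvature e r $ i \<noteq> curvature e r $ j \<Longrightarrow> curvature e r \<bullet> F r < 0"
    and const: "\<And>r. (\<And>i j. curvature e r $ i = curvature e r $ j) \<Longrightarrow> curvature e r \<bullet> F r \<le> 0"
  shows "solutions_converge_to F r0 (\<lambda>r. \<forall>i. curvature e r $ i = mean_curvature V E) \<longleftrightarrow> sparse"
proof
  assume "solutions_converge_to F r0 (\<lambda>r. \<forall>i. curvature e r $ i = mean_curvature V E)"
  \<comment> \<open>The existence clause of \<open>solutions_converge_to\<close> supplies a maximal
    solution, and its limit is the required weight.\<close>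
  then obtain l where "\<forall>i. curvature e l $ i = mean_curvature V E"
    unfolding solutions_converge_to_def by blast
  then show sparse using constant_curvature_imp_sparse by blast
next
  assume sparse
  then obtain l where l: "1 \<bullet> l = 1 \<bullet> r0" "\<And>i. curvature e l $ i = mean_curvature V E"
    using sparse_imp_constant_curvature by metis
  let ?f' = "\<lambda>r. curvature e r - vec (mean_curvature V E)"
  have shift: "?f' r \<bullet> F r = curvature e r \<bullet> F r" for r
  proof -
    have "vec (mean_curvature V E) \<bullet> F r = mean_curvature V E * (1 \<bullet> F r)"
      by (simp add: inner_vec_def sum_distrib_left)
    then show ?thesis by (simp add: inner_diff_left conserved)
  qed
  show "solutions_converge_to F r0 (\<lambda>r. \<forall>i. curvature e r $ i = mean_curvature V E)"
  proof (rule lyapunov_flow_converges[OF F potential_has_derivative _ _ conserved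
      compact_potential_sublevel[OF \<open>sparse\<close>] l(1)])
    show "continuous_on UNIV ?f'" by (intro continuous_intros continuous_curvature)
    show "?f' r \<bullet> F r \<le> 0" for r
      unfolding shift using descent[of r] const[of r] by (meson less_imp_le)
    show "\<forall>i. curvature e l $ i = mean_curvature V E" using l by blast
    fix r assume r: "1 \<bullet> r = 1 \<bullet> r0" "r \<noteq> l"
    have less: "potential l < potential r"
      using r l by (intro potential_strict_min) (auto simp: inner_one)
    \<comment> \<open>A constant curvature at r would equal \<kappa>bar, and then r and l would each
      have strictly smaller potential than the other.\<close>
    have "\<exists>i j. curvature e r $ i \<noteq> curvature e r $ j"
    proof (rule ccontr)
      assume "\<not> ?thesis"
      then have const: "curvature e r $ i = curvature e r $ undefined" for i by blast
      have "(\<Sum>i\<in>UNIV. curvature e r $ i) = (\<Sum>i\<in>(UNIV :: 'n set). curvature e r $ undefined)"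
        by (rule sum.cong[OF refl const])
      then have "curvature e r $ i = mean_curvature V E" for i
        using const[of i] sum_curvature[of r] by simp
      then have "potential r < potential l"
        using r l by (intro potential_strict_min) (auto simp: inner_one)
      then show False using less by simp
    qed
    then have "?f' r \<bullet> F r < 0" unfolding shift using descent by blast
    then show "potential l < potential r \<and> ?f' r \<bullet> F r < 0" using less by simp
  qed
qed

section \<open>The Laplacian, p-Laplacian and fractional flows\<close>

lemma flux_flow_converges_iff:
  assumes "continuous_on UNIV \<psi>" "\<And>a. \<psi> (- a) = - \<psi> a" "\<And>a. a \<noteq> 0 \<Longrightarrow> a * \<psi> a > 0"
  shows "solutions_converge_to (\<lambda>r. flux \<psi> r (curvature e r)) r0
      (\<lambda>r. \<forall>i. curvature e r $ i = mean_curvature V E) \<longleftrightarrow> sparse"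
  using assms
  by (intro flow_converges_iff continuous_flux sum_flux inner_flux_neg inner_flux_nonpos) auto

lemma laplacian_flux: "laplacian e r g = flux (\<lambda>a. a) r g"
  by (simp add: laplacian_def curvature_jacobian_flux)

lemma p_laplacian_flux:
  "p_laplacian p e r (g - vec c) = flux (\<lambda>a. \<bar>a\<bar> powr (p - 2) * a) r g"
proof -
  have "(\<Sum>j | e j \<noteq> e i \<and> e j \<inter> e i \<noteq> {}. (- curvature_jacobian e r $ i $ j) *
      (\<bar>g $ j - g $ i\<bar> powr (p - 2) * (g $ j - g $ i))) =
      (\<Sum>j\<in>UNIV. coupling r i j * (\<bar>g $ j - g $ i\<bar> powr (p - 2) * (g $ j - g $ i)))" for i
  proof (rule sum.mono_neutral_cong_left)
    \<comment> \<open>The added indices contribute nothing: disjoint edges have no coupling, and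
      \<open>e j = e i\<close> means j = i, where the difference is 0.\<close>
    show "\<forall>j\<in>UNIV - {j. e j \<noteq> e i \<and> e j \<inter> e i \<noteq> {}}.
        coupling r i j * (\<bar>g $ j - g $ i\<bar> powr (p - 2) * (g $ j - g $ i)) = 0"
      using enum coupling_disjoint[of i] by (auto simp: bij_betw_def inj_def Int_commute)
    fix j assume "j \<in> {j. e j \<noteq> e i \<and> e j \<inter> e i \<noteq> {}}"
    then have "i \<noteq> j" by auto
    then show "(- curvature_jacobian e r $ i $ j) * (\<bar>g $ j - g $ i\<bar> powr (p - 2) * (g $ j - g $ i)) =
        coupling r i j * (\<bar>g $ j - g $ i\<bar> powr (p - 2) * (g $ j - g $ i))"
      by (simp add: curvature_jacobian_offdiag)
  qed auto
  then show ?thesis by (simp add: p_laplacian_def flux_def)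
qed

text \<open>All J(r) have the constants as kernel, so one unit vector u serves every r: J(r) + u u^T
  is positive definite, and u u^T is subtracted again after taking the power.\<close>

lemma continuous_frac_laplacian:
  "continuous_on UNIV (\<lambda>r. frac_laplacian s e r (curvature e r))"
proof -
  define u :: "real ^ 'n" where "u = vec (1 / sqrt CARD('n))"
  let ?J = "curvature_jacobian e"
  have u: "norm u = 1" by (simp add: u_def norm_eq_1 inner_vec_def)
  have Ju: "?J r *v u = 0" for r
    by (simp add: u_def vec_eq_iff curvature_jacobian_mult_vec)
  have ker: "\<exists>c. x = c *\<^sub>R u" if "?J r *v x = 0" for r x
  proof
    have "x $ i = x $ undefined" for i using curvature_jacobian_kernel[OF that] .
    then show "x = (x $ undefined * sqrt CARD('n)) *\<^sub>R u"
      by (simp add: vec_eq_iff u_def)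
  qed
  have power: "matrix_real_power (?J r) s = matrix_real_power (?J r + rank_one u) s - rank_one u" for r
    using matrix_real_power_add_kernel_projection[OF transpose_curvature_jacobian u Ju ker] by simp
  have "transpose (?J r + rank_one u) = ?J r + rank_one u" for r
  proof -
    have "transpose (rank_one u) = rank_one u"
      by (simp add: rank_one_def transpose_def mult.commute)
    moreover have "transpose (?J r + rank_one u) = transpose (?J r) + transpose (rank_one u)"
      by (simp add: transpose_def vec_eq_iff)
    ultimately show ?thesis by (simp add: transpose_curvature_jacobian)
  qed
  moreover have "x \<bullet> ((?J r + rank_one u) *v x) > 0" if "x \<noteq> 0" for x r
  proof -
    have eq: "x \<bullet> ((?J r + rank_one u) *v x) = x \<bullet> (?J r *v x) + (u \<bullet> x)\<^sup>2"
      by (simp add: matrix_vector_mult_add_rdistrib rank_one_mult_vec inner_add_right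
          inner_commute power2_eq_square)
    show ?thesis
    proof (cases "\<exists>i j. x $ i \<noteq> x $ j")
      case True
      then have "x \<bullet> flux (\<lambda>a. a) r x < 0"
        by (elim exE, intro inner_flux_neg) (auto simp flip: power2_eq_square)
      moreover have "(u \<bullet> x)\<^sup>2 \<ge> 0" by simp
      ultimately show ?thesis
        unfolding eq curvature_jacobian_flux inner_minus_right by linarith
    next
      case False
      then have c: "x $ i = x $ undefined" for i by blast
      then have "x $ undefined \<noteq> 0" using that by (metis vec_eq_iff zero_index)
      moreover have "u \<bullet> x = (\<Sum>i\<in>(UNIV::'n set). 1 / sqrt CARD('n) * x $ undefined)"
        unfolding inner_vec_def using c by (intro sum.cong) (auto simp: u_def)
      ultimately have "u \<bullet> x \<noteq> 0" by simp
      then show ?thesis unfolding eq using curvature_jacobian_inner_nonneg[of x r]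
        by (simp add: add_nonneg_pos)
    qed
  qed
  ultimately have "continuous_on UNIV (\<lambda>r. matrix_real_power (?J r + rank_one u) s)"
    by (intro continuous_on_compose2[OF continuous_on_matrix_real_power]
        continuous_intros continuous_curvature_jacobian) auto
  then have "continuous_on UNIV (\<lambda>r. matrix_real_power (?J r) s)"
    unfolding power by (intro continuous_intros)
  then show ?thesis
    unfolding frac_laplacian_def matrix_vector_mult_def
    by (intro continuous_intros continuous_on_vec_lambda continuous_curvature)
qed

text \<open>Conservation holds because J^s is symmetric and annihilates constants. Descent holds
  because its quadratic form is positive off the kernel of J, that is, off the constants.\<close>

lemma frac_laplacian_flow_converges_iff:
  "solutions_converge_to (\<lambda>r. frac_laplacian s e r (curvature e r)) r0
    (\<lambda>r. \<forall>i. curvature e r $ i = mean_curvature V E) \<longleftrightarrow> sparse"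
proof (rule flow_converges_iff[OF continuous_frac_laplacian])
  fix r
  note sym = transpose_curvature_jacobian[of r]
  let ?P = "matrix_real_power (curvature_jacobian e r) s"
  have "curvature_jacobian e r *v 1 = 0"
    by (simp add: vec_eq_iff curvature_jacobian_mult_vec)
  then have "?P *v 1 = 0" by (rule matrix_real_power_kernel[OF sym])
  then show "1 \<bullet> frac_laplacian s e r (curvature e r) = 0"
    by (simp add: frac_laplacian_def symmetric_matrix_inner[OF transpose_matrix_real_power[OF sym], symmetric])
  show "curvature e r \<bullet> frac_laplacian s e r (curvature e r) \<le> 0"
    using matrix_real_power_inner_nonneg[OF sym] by (simp add: frac_laplacian_def)
  fix i j assume "curvature e r $ i \<noteq> curvature e r $ j"
  then have "curvature_jacobian e r *v curvature e r \<noteq> 0" using curvature_jacobian_kernel by blast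
  then show "curvature e r \<bullet> frac_laplacian s e r (curvature e r) < 0"
    using matrix_real_power_inner_pos[OF sym] by (simp add: frac_laplacian_def)
qed

end

text \<open>The delicate point is 0, where |a|^(p-2) blows up for p < 2; the product has absolute
  value |a|^(p-1), which tends to 0 since p > 1.\<close>

lemma continuous_signed_powr:
  fixes p :: real
  assumes "p > 1"
  shows "continuous_on UNIV (\<lambda>a :: real. \<bar>a\<bar> powr (p - 2) * a)"
proof -
  have "isCont (\<lambda>a. \<bar>a\<bar> powr (p - 2) * a) x" for x :: real
  proof (cases "x = 0")
    case True
    have "((\<lambda>a :: real. \<bar>a\<bar> powr (p - 1)) \<longlongrightarrow> \<bar>0\<bar> powr (p - 1)) (at 0)"
      using assms by (intro tendsto_powr' tendsto_intros) auto
    then have lim: "((\<lambda>a :: real. \<bar>a\<bar> powr (p - 1)) \<longlongrightarrow> 0) (at 0)" by simp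
    have eq: "\<bar>a\<bar> powr (p - 1) = \<bar>\<bar>a\<bar> powr (p - 2) * a\<bar>" for a :: real
    proof (cases "a = 0")
      case False
      then show ?thesis
        using powr_add[of "\<bar>a\<bar>" "p - 2" 1] by (simp add: abs_mult)
    qed simp
    have "((\<lambda>a :: real. \<bar>a\<bar> powr (p - 2) * a) \<longlongrightarrow> 0) (at 0)"
      by (rule tendsto_rabs_zero_cancel) (rule lim[unfolded eq])
    then show ?thesis using True by (simp add: isCont_def)
  qed (auto intro!: continuous_intros)
  then show ?thesis by (simp add: continuous_at_imp_continuous_on)
qed

theorem corollary2p5:
  fixes V :: "'v set" and E :: "'v set set" and e :: "'n::finite \<Rightarrow> 'v set"
    and r0 :: "real ^ 'n" and s p :: real
  assumes "finite_simple_graph V E" and "connected_graph V E" and "6 \<le> girth E"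
    and "bij_betw e UNIV E"
    and "p > 1"
  defines "\<kappa>bar \<equiv> mean_curvature V E"
  defines "const_curv \<equiv> (\<lambda>r. \<forall>i. curvature e r $ i = \<kappa>bar)"
  defines "density_cond \<equiv>
      Max {real (card (induced_edges E \<Omega>)) / real (card \<Omega>) | \<Omega>. \<Omega> \<noteq> {} \<and> \<Omega> \<subset> V}
        < real (card E) / real (card V)"
  shows "(solutions_converge_to (\<lambda>r. laplacian e r (curvature e r)) r0 const_curv
            \<longleftrightarrow> density_cond) \<and>
         (solutions_converge_to (\<lambda>r. frac_laplacian s e r (curvature e r)) r0 const_curv
            \<longleftrightarrow> density_cond) \<and>
         (solutions_converge_to (\<lambda>r. p_laplacian p e r (curvature e r - vec \<kappa>bar)) r0 const_curv
            \<longleftrightarrow> density_cond)"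
proof -
  interpret enumerated_graph V E e using assms(1,2,4) by unfold_locales
  have pos: "a * (\<bar>a\<bar> powr (p - 2) * a) > 0" if "a \<noteq> 0" for a :: real
  proof -
    have "a * (\<bar>a\<bar> powr (p - 2) * a) = \<bar>a\<bar> powr (p - 2) * (a * a)" by simp
    also have "\<dots> > 0"
      by (rule mult_pos_pos) (use that in \<open>auto simp: zero_less_mult_iff linorder_neq_iff\<close>)
    finally show ?thesis .
  qed
  show ?thesis
    unfolding const_curv_def density_cond_def \<kappa>bar_def sparse_iff[symmetric]
      p_laplacian_flux laplacian_flux
    using flux_flow_converges_iff[of "\<lambda>a. a" r0]
      flux_flow_converges_iff[OF continuous_signed_powr[OF assms(5)] _ pos, of r0]
      frac_laplacian_flow_converges_iff[of s r0]
    by (auto simp: zero_less_mult_iff linorder_neq_iff)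
qed

end
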